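(* Let $G$ be a totally disconnected locally compact abelian group and let $\phi:G\to G$ be a continuous endomorphism. Then $h_{top}(\phi)=h_{alg}(\widehat\phi)$, where $\widehat\phi:\widehat G\to\widehat G$ is the Pontryagin dual endomorphism of $\phi$.
   Context: Locally compact abelian groups are Hausdorff and written additively. For a locally compact abelian group $G$, let $\mathcal C(G)$ be the family of all compact neighborhoods of $0$ in $G$, and let $\mu$ be a Haar measure on $G$. Let $\phi:G\to G$ be a continuous endomorphism. For $U\in\mathcal C(G)$ and a positive integer $n$ put $C_n(\phi,U)=U\cap\phi^{-1}(U)\cap\ldots\cap\phi^{-n+1}(U)$ and $T_n(\phi,U)=U+\phi(U)+\ldots+\phi^{n-1}(U)$. Define $$H_{top}(\phi,U)=\limsup_{n\to\infty}\frac{-\log\mu(C_n(\phi,U))}{n},\qquad H_{alg}(\phi,U)=\limsup_{n\to\infty}\frac{\log\mu(T_n(\phi,U))}{n}$$ (these do not depend on the choice of $\mu$). The topological entropy is $h_{top}(\phi)=\sup\{H_{top}(\phi,U):U\in\mathcal C(G)\}$ and the algebraic entropy is $h_{alg}(\phi)=\sup\{H_{alg}(\phi,U):U\in\mathcal C(G)\}$; both take values in $[0,\infty]$. The Pontryagin dual $\widehat G$ is the locally compact abelian group of all continuous homomorphisms $\chi:G\to\mathbb T$ with the compact-open topology, and $\widehat\phi:\widehat G\to\widehat G$ is given by $\widehat\phi(\chi)=\chi\circ\phi$. *)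

theory Defs
  imports "HOL-Analysis.Analysis"
begin

section \<open>Topological preliminaries\<close>

definition totally_disconnected :: "'a::topological_space set \<Rightarrow> bool" where
  "totally_disconnected S \<longleftrightarrow> (\<forall>x\<in>S. connected_component_set S x = {x})"

definition compact_nhds0 :: "'a::{topological_space, zero} set set" where
  "compact_nhds0 = {U. compact U \<and> 0 \<in> interior U}"

definition continuous_endo :: "('a::topological_ab_group_add \<Rightarrow> 'a) \<Rightarrow> bool" where
  "continuous_endo \<phi> \<longleftrightarrow> Modules.additive \<phi> \<and> continuous_on UNIV \<phi>"


section \<open>Haar measures\<close>

text \<open>A Haar measure is a nonzero translation-invariant Radon measure on the Borel sets, where
  Radon means: finite on compact sets, outer regular on Borel sets, inner regular on open sets.\<close>

definition haar_measure :: "'a::topological_ab_group_add measure \<Rightarrow> bool" where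
  "haar_measure \<mu> \<longleftrightarrow>
     sets \<mu> = sets borel \<and>
     emeasure \<mu> UNIV \<noteq> 0 \<and>
     (\<forall>x. \<forall>A\<in>sets borel. emeasure \<mu> ((+) x ` A) = emeasure \<mu> A) \<and>
     (\<forall>K. compact K \<longrightarrow> emeasure \<mu> K < \<infinity>) \<and>
     (\<forall>A\<in>sets borel. emeasure \<mu> A = (INF V\<in>{V. open V \<and> A \<subseteq> V}. emeasure \<mu> V)) \<and>
     (\<forall>V. open V \<longrightarrow> emeasure \<mu> V = (SUP K\<in>{K. compact K \<and> K \<subseteq> V}. emeasure \<mu> K))"


section \<open>Topological and algebraic entropy\<close>

definition cotrajectory :: "('a \<Rightarrow> 'a) \<Rightarrow> 'a set \<Rightarrow> nat \<Rightarrow> 'a set" where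
  "cotrajectory \<phi> U n = (\<Inter>k<n. (\<phi> ^^ k) -` U)"

text \<open>The sum below is the Minkowski sum of sets from \<^theory>\<open>HOL-Library.Set_Algebras\<close>.\<close>

definition trajectory :: "('a::ab_group_add \<Rightarrow> 'a) \<Rightarrow> 'a set \<Rightarrow> nat \<Rightarrow> 'a set" where
  "trajectory \<phi> U n = (\<Sum>k<n. (\<phi> ^^ k) ` U)"

text \<open>For a continuous endomorphism, a compact neighbourhood \<open>U\<close> of \<open>0\<close>, a Haar measure \<open>\<mu>\<close> of a
  Hausdorff group and \<open>n > 0\<close>, the two sets above are compact neighbourhoods of \<open>0\<close>; their measure
  is a positive real number, so the real-valued \<^const>\<open>measure\<close> and \<^const>\<open>ln\<close> lose nothing.
  The term for \<open>n = 0\<close> does not influence the limit superior.\<close>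

definition H_top :: "'a::topological_ab_group_add measure \<Rightarrow> ('a \<Rightarrow> 'a) \<Rightarrow> 'a set \<Rightarrow> ereal" where
  "H_top \<mu> \<phi> U = limsup (\<lambda>n. ereal (- ln (measure \<mu> (cotrajectory \<phi> U n)) / real n))"

definition H_alg :: "'a::topological_ab_group_add measure \<Rightarrow> ('a \<Rightarrow> 'a) \<Rightarrow> 'a set \<Rightarrow> ereal" where
  "H_alg \<mu> \<phi> U = limsup (\<lambda>n. ereal (ln (measure \<mu> (trajectory \<phi> U n)) / real n))"

definition h_top :: "'a::topological_ab_group_add measure \<Rightarrow> ('a \<Rightarrow> 'a) \<Rightarrow> ereal" where
  "h_top \<mu> \<phi> = (SUP U\<in>compact_nhds0. H_top \<mu> \<phi> U)"

definition h_alg :: "'a::topological_ab_group_add measure \<Rightarrow> ('a \<Rightarrow> 'a) \<Rightarrow> ereal" where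
  "h_alg \<mu> \<phi> = (SUP U\<in>compact_nhds0. H_alg \<mu> \<phi> U)"


section \<open>The Pontryagin dual\<close>

text \<open>The circle group is the multiplicative group of complex numbers of modulus \<open>1\<close>. The dual group
  is nevertheless written additively: its sum is the pointwise product of characters.\<close>

definition is_character :: "('a::topological_ab_group_add \<Rightarrow> complex) \<Rightarrow> bool" where
  "is_character \<xi> \<longleftrightarrow>
     continuous_on UNIV \<xi> \<and> (\<forall>x. norm (\<xi> x) = 1) \<and> (\<forall>x y. \<xi> (x + y) = \<xi> x * \<xi> y)"

typedef (overloaded) 'a dual = "{\<xi> :: 'a::topological_ab_group_add \<Rightarrow> complex. is_character \<xi>}"
  morphisms char_of Abs_dual
  by (rule exI[of _ "\<lambda>_. 1"]) (simp add: is_character_def)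

setup_lifting type_definition_dual

lemma is_character_char_of: "is_character (char_of \<xi>)"
  using char_of[of \<xi>] by simp

lemma continuous_char_of: "continuous_on S (char_of \<xi>)"
  using is_character_char_of[of \<xi>] continuous_on_subset by (auto simp: is_character_def)

lemma norm_char_of [simp]: "norm (char_of \<xi> x) = 1"
  using is_character_char_of[of \<xi>] by (simp add: is_character_def)

lemma char_of_nonzero [simp]: "char_of \<xi> x \<noteq> 0"
  using norm_char_of[of \<xi> x] by (metis norm_zero zero_neq_one)

lemma char_of_add: "char_of \<xi> (x + y) = char_of \<xi> x * char_of \<xi> y"
  using is_character_char_of[of \<xi>] by (simp add: is_character_def)

instantiation dual :: (topological_ab_group_add) ab_group_add
begin

lift_definition zero_dual :: "'a dual" is "\<lambda>_. 1"
  by (simp add: is_character_def)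

lift_definition plus_dual :: "'a dual \<Rightarrow> 'a dual \<Rightarrow> 'a dual" is "\<lambda>\<xi> \<psi> x. \<xi> x * \<psi> x"
  by (auto simp: is_character_def norm_mult intro!: continuous_intros)

lift_definition uminus_dual :: "'a dual \<Rightarrow> 'a dual" is "\<lambda>\<xi> x. inverse (\<xi> x)"
  by (auto simp: is_character_def norm_inverse intro!: continuous_intros)
     (metis norm_zero zero_neq_one)

definition minus_dual :: "'a dual \<Rightarrow> 'a dual \<Rightarrow> 'a dual" where
  "minus_dual \<xi> \<psi> = \<xi> + - \<psi>"

instance
proof
  fix a b c :: "'a dual"
  show "a + b + c = a + (b + c)" by transfer (simp add: mult.assoc)
  show "a + b = b + a" by transfer (simp add: mult.commute)
  show "0 + a = a" by transfer simp
  show "- a + a = 0"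
    by transfer (auto simp: is_character_def fun_eq_iff, metis left_inverse norm_zero zero_neq_one)
  show "a - b = a + - b" by (simp add: minus_dual_def)
qed

end

text \<open>The compact-open topology. Since characters take values in the unit circle, letting \<open>W\<close> range
  over the open subsets of the complex plane amounts to letting it range over those of the circle.\<close>

instantiation dual :: (topological_ab_group_add) topological_space
begin

definition open_dual :: "'a dual set \<Rightarrow> bool" where
  "open_dual = generate_topology
     {{\<xi>. char_of \<xi> ` K \<subseteq> W} | K W. compact K \<and> open W}"

instance
  by intro_classes (auto simp: open_dual_def
      intro: generate_topology.UNIV generate_topology.Int generate_topology.UN)

end

lemma tendsto_dual_iff:
  fixes f :: "'b \<Rightarrow> 'a::topological_ab_group_add dual"
  shows "(f \<longlongrightarrow> \<xi>) F \<longleftrightarrow>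
    (\<forall>K. compact K \<longrightarrow> uniform_limit K (\<lambda>i. char_of (f i)) (char_of \<xi>) F)"
proof (intro iffI allI impI)
  fix K :: "'a set" assume lim: "(f \<longlongrightarrow> \<xi>) F" and K: "compact K"
  show "uniform_limit K (\<lambda>i. char_of (f i)) (char_of \<xi>) F"
  proof (rule uniform_limitI)
    fix e :: real assume e: "e > 0"
    define N where "N x = char_of \<xi> -` ball (char_of \<xi> x) (e / 3)" for x
    define L where "L x = K \<inter> char_of \<xi> -` cball (char_of \<xi> x) (e / 3)" for x
    define S where "S x = {\<psi>. char_of \<psi> ` L x \<subseteq> ball (char_of \<xi> x) (e / 2)}" for x
    have "open (N x)" for x
      unfolding N_def using continuous_char_of by (intro open_vimage) auto
    moreover have "K \<subseteq> (\<Union>x\<in>K. N x)"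
      using e by (auto simp: N_def)
    ultimately obtain D where D: "D \<subseteq> K" "finite D" "K \<subseteq> (\<Union>x\<in>D. N x)"
      using compactE_image[OF K, of K N] by metis
    have "compact (L x)" for x
      unfolding L_def using K continuous_char_of by (intro compact_Int_closed closed_vimage) auto
    then have "open (S x)" for x
      unfolding S_def open_dual_def by (intro generate_topology.Basis) blast
    moreover have "\<xi> \<in> S x" for x
      using e by (auto simp: S_def L_def)
    ultimately have "\<forall>\<^sub>F i in F. \<forall>x\<in>D. f i \<in> S x"
      using lim D(2) by (intro eventually_ball_finite) (auto dest: topological_tendstoD)
    then show "\<forall>\<^sub>F i in F. \<forall>y\<in>K. dist (char_of (f i) y) (char_of \<xi> y) < e"
    proof eventually_elim
      case (elim i)
      show ?case
      proof
        fix y assume "y \<in> K"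
        then obtain x where x: "x \<in> D" "y \<in> N x" using D by blast
        then have "y \<in> L x" using \<open>y \<in> K\<close> by (auto simp: N_def L_def)
        then have "dist (char_of \<xi> x) (char_of (f i) y) < e / 2"
          using elim x unfolding S_def by (metis image_subset_iff mem_Collect_eq mem_ball)
        moreover have "dist (char_of \<xi> x) (char_of \<xi> y) < e / 3"
          using x by (auto simp: N_def)
        ultimately show "dist (char_of (f i) y) (char_of \<xi> y) < e"
          using dist_triangle3[of "char_of (f i) y" "char_of \<xi> y" "char_of \<xi> x"] e by linarith
      qed
    qed
  qed
next
  assume lim: "\<forall>K. compact K \<longrightarrow> uniform_limit K (\<lambda>i. char_of (f i)) (char_of \<xi>) F"
  show "(f \<longlongrightarrow> \<xi>) F"
    unfolding nhds_generated_topology[OF open_dual_def] filterlim_INF filterlim_principal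
  proof (rule ballI, elim CollectE conjE exE)
    fix S K W assume S: "\<xi> \<in> S" "S = {\<psi>. char_of \<psi> ` K \<subseteq> W}" "compact K" "open W"
    then have "compact (char_of \<xi> ` K)"
      using continuous_char_of compact_continuous_image by blast
    with S obtain e where e: "e > 0" "(\<Union>z\<in>char_of \<xi> ` K. ball z e) \<subseteq> W"
      using compact_subset_open_imp_ball_epsilon_subset[of "char_of \<xi> ` K" W] by auto
    have "\<forall>\<^sub>F i in F. \<forall>x\<in>K. dist (char_of (f i) x) (char_of \<xi> x) < e"
      using lim S e by (auto intro: uniform_limitD)
    then show "\<forall>\<^sub>F i in F. f i \<in> S"
      by eventually_elim (use e S in \<open>fastforce simp: dist_commute\<close>)
  qed
qed

instance dual :: (topological_ab_group_add) topological_ab_group_add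
proof
  fix a b :: "'a dual"
  have bdd: "bounded (char_of c ` K)" for c :: "'a dual" and K
    by (auto simp: bounded_iff)
  have fst: "(fst \<longlongrightarrow> a) (nhds a \<times>\<^sub>F nhds b)"
    by (rule filterlim_fst)
  have snd: "(snd \<longlongrightarrow> b) (nhds a \<times>\<^sub>F nhds b)"
    by (rule filterlim_snd)
  show "((\<lambda>x. fst x + snd x) \<longlongrightarrow> a + b) (nhds a \<times>\<^sub>F nhds b)"
    using fst snd unfolding tendsto_dual_iff plus_dual.rep_eq
    by (intro allI impI uniform_lim_mult bdd) simp_all
  have "((\<lambda>x. x) \<longlongrightarrow> a) (nhds a)"
    by (rule filterlim_ident)
  then show "(uminus \<longlongrightarrow> - a) (nhds a)"
    unfolding tendsto_dual_iff uminus_dual.rep_eq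
    using uniform_lim_inverse[where f = char_of and l = "char_of a" and b = 1]
    by (simp add: comp_def)
qed

instance dual :: (topological_ab_group_add) t2_space
proof
  fix \<xi> \<psi> :: "'a dual" assume "\<xi> \<noteq> \<psi>"
  then obtain x where "char_of \<xi> x \<noteq> char_of \<psi> x"
    by (metis char_of_inject ext)
  then obtain V W where VW: "open V" "open W" "char_of \<xi> x \<in> V" "char_of \<psi> x \<in> W" "V \<inter> W = {}"
    by (metis hausdorff)
  have "open {\<zeta>. char_of \<zeta> ` {x} \<subseteq> V'}" if "open V'" for V'
    unfolding open_dual_def using that
    by (intro generate_topology.Basis CollectI exI[of _ "{x}"] exI[of _ V']) simp
  with VW show "\<exists>U V. open U \<and> open V \<and> \<xi> \<in> U \<and> \<psi> \<in> V \<and> U \<inter> V = {}"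
    by (intro exI[of _ "{\<zeta>. char_of \<zeta> ` {x} \<subseteq> V}"] exI[of _ "{\<zeta>. char_of \<zeta> ` {x} \<subseteq> W}"]) auto
qed

text \<open>The value below is meaningful only if \<open>\<phi>\<close> is a continuous endomorphism;
  otherwise the composition need not be a character.\<close>

definition dual_endo :: "('a::topological_ab_group_add \<Rightarrow> 'a) \<Rightarrow> 'a dual \<Rightarrow> 'a dual" where
  "dual_endo \<phi> \<xi> = Abs_dual (char_of \<xi> \<circ> \<phi>)"

lemma char_of_dual_endo:
  assumes "continuous_endo \<phi>"
  shows "char_of (dual_endo \<phi> \<xi>) = char_of \<xi> \<circ> \<phi>"
proof -
  have "is_character (char_of \<xi> \<circ> \<phi>)"
    using assms continuous_on_compose[of UNIV \<phi> "char_of \<xi>"] continuous_char_of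
    by (auto simp: is_character_def continuous_endo_def Modules.additive_def char_of_add)
  then show ?thesis
    by (simp add: dual_endo_def Abs_dual_inverse)
qed

end

theory Submission
  imports Defs
begin

text \<open>By van Dantzig's theorem the compact open subgroups \<open>U\<close> form a neighbourhood base of \<open>0\<close> in the
  group, and since the circle has no small subgroups, their annihilators are compact open subgroups of
  the dual that eventually contain every compact set. By monotonicity both entropies are therefore
  suprema over these subgroups. As characters extend from subgroups, the annihilator of the \<open>n\<close>-th
  cotrajectory of \<open>U\<close> is the \<open>n\<close>-th trajectory of the annihilator of \<open>U\<close>. Finally
  \<open>\<mu>(C) \<nu>(C\<^sup>\<bottom>)\<close> is the same for all compact open subgroups \<open>C\<close> of \<open>U\<close>, so the
  logarithms of the two measures differ by a constant, which disappears after division by \<open>n\<close>.\<close>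

section \<open>Integer multiples and extension of characters\<close>

text \<open>Characters extend because the circle is divisible: a homomorphism can be prolonged by
  one element at a time, and Zorn's lemma does the rest. This extension is purely algebraic.
  Continuity is recovered afterwards, since a homomorphism that is trivial on an open subgroup is
  locally constant; each use is therefore arranged so that the prescribed part already kills an open
  subgroup. The constancy of \<open>\<mu>(C) \<nu>(C\<^sup>\<bottom>)\<close> amounts to
  \<open>[U : C] = [C\<^sup>\<bottom> : U\<^sup>\<bottom>]\<close>, that is, to a finite abelian
  group having as many characters as elements. Quotients appear only through disjoint cosets:
  \<open>C\<close> is enlarged by one element at a time, where the quotient is cyclic and its
  characters correspond to roots of unity. Each enlargement at least doubles the measure, so
  \<open>U\<close> is reached after finitely many of them.\<close>

definition int_mult :: "int \<Rightarrow> 'a::ab_group_add \<Rightarrow> 'a" where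
  "int_mult i x = (\<Sum>_\<in>{0..<i}. x) - (\<Sum>_\<in>{i..<0}. x)"

lemma int_mult_0 [simp]: "int_mult 0 x = 0"
  by (simp add: int_mult_def)

text \<open>At most one of the two intervals in \<open>int_mult\<close> is nonempty. Raising
  \<open>i\<close> adds the point \<open>i\<close> to the first one or removes it from the second.
  With the value at 0, this recursion yields the other laws by induction in both directions.\<close>

lemma int_mult_succ: "int_mult (i + 1) x = int_mult i x + x"
proof (cases "i \<ge> 0")
  case True
  then have "{0..<i + 1} = insert i {0..<i}" by auto
  with True show ?thesis by (simp add: int_mult_def)
next
  case False
  then have "{i..<0} = insert i {i + 1..<0}" by auto
  with False show ?thesis by (simp add: int_mult_def)
qed

lemma int_mult_1 [simp]: "int_mult 1 x = x"
  using int_mult_succ[of 0 x] by simp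

lemma int_mult_pred: "int_mult (i - 1) x = int_mult i x - x"
  using int_mult_succ[of "i - 1" x] by simp

lemma int_mult_add: "int_mult (i + j) x = int_mult i x + int_mult j x"
proof (induction j rule: int_induct[where k = 0])
  case (step1 j)
  then show ?case using int_mult_succ[of "i + j" x] int_mult_succ[of j x] by (simp add: add.assoc)
next
  case (step2 j)
  have "int_mult (i + (j - 1)) x = int_mult (i + j) x - x"
    using int_mult_pred[of "i + j" x] by (simp add: algebra_simps)
  then show ?case using step2 by (simp add: int_mult_pred)
qed simp

lemma int_mult_diff: "int_mult (i - j) x = int_mult i x - int_mult j x"
  using int_mult_add[of "i - j" j x] by simp

lemma int_mult_mult: "int_mult (i * j) x = int_mult i (int_mult j x)"
proof (induction i rule: int_induct[where k = 0])
  case (step1 i)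
  then show ?case by (simp add: int_mult_add distrib_right)
next
  case (step2 i)
  then show ?case by (simp add: int_mult_diff left_diff_distrib)
qed simp

section \<open>Additive subgroups and partial homomorphisms to the circle\<close>

definition add_subgroup :: "'a::ab_group_add set \<Rightarrow> bool" where
  "add_subgroup H \<longleftrightarrow> 0 \<in> H \<and> (\<forall>x\<in>H. \<forall>y\<in>H. x - y \<in> H)"

lemma add_subgroup_0: "add_subgroup H \<Longrightarrow> 0 \<in> H"
  and add_subgroup_diff: "add_subgroup H \<Longrightarrow> x \<in> H \<Longrightarrow> y \<in> H \<Longrightarrow> x - y \<in> H"
  by (simp_all add: add_subgroup_def)

lemma add_subgroup_uminus: "add_subgroup H \<Longrightarrow> x \<in> H \<Longrightarrow> - x \<in> H"
  using add_subgroup_diff[of H 0 x] add_subgroup_0[of H] by simp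

lemma add_subgroup_add: "add_subgroup H \<Longrightarrow> x \<in> H \<Longrightarrow> y \<in> H \<Longrightarrow> x + y \<in> H"
  using add_subgroup_diff[of H x "- y"] add_subgroup_uminus[of H y] by simp

lemma add_subgroup_int_mult:
  assumes "add_subgroup H" "x \<in> H"
  shows "int_mult i x \<in> H"
proof (induction i rule: int_induct[where k = 0])
  case base
  then show ?case using assms by (simp add: add_subgroup_0)
next
  case (step1 i)
  then show ?case using assms by (simp add: int_mult_succ add_subgroup_add)
next
  case (step2 i)
  then show ?case using assms by (simp add: int_mult_pred add_subgroup_diff)
qed

lemma add_subgroup_vimage_diff:
  assumes "add_subgroup H" "x - y \<in> H"
  shows "x \<in> H \<longleftrightarrow> y \<in> H"
  using add_subgroup_add[OF assms(1) _ assms(2), of y]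
    add_subgroup_diff[OF assms(1) _ assms(2), of x] by auto

text \<open>Graph of a homomorphism from a subgroup to the circle. Since the graph is a subgroup of the
  product, the last clause expresses that it is single-valued.\<close>

definition circle_hom_graph :: "('a::ab_group_add \<times> complex) set \<Rightarrow> bool" where
  "circle_hom_graph P \<longleftrightarrow> (0, 1) \<in> P \<and> (\<forall>x z. (x, z) \<in> P \<longrightarrow> norm z = 1) \<and>
     (\<forall>x z y w. (x, z) \<in> P \<longrightarrow> (y, w) \<in> P \<longrightarrow> (x - y, z / w) \<in> P) \<and> (\<forall>z. (0, z) \<in> P \<longrightarrow> z = 1)"

lemma circle_hom_graph_unique:
  assumes "circle_hom_graph P" "(x, z) \<in> P" "(x, w) \<in> P"
  shows "z = w"
proof -
  have "(x - x, z / w) \<in> P" using assms unfolding circle_hom_graph_def by blast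
  then have "(0, z / w) \<in> P" by simp
  then have "z / w = 1" using assms(1) unfolding circle_hom_graph_def by blast
  then show ?thesis by (metis right_inverse_eq divide_eq_0_iff zero_neq_one)
qed

lemma circle_hom_graph_add:
  assumes "circle_hom_graph P" "(x, z) \<in> P" "(y, w) \<in> P"
  shows "(x + y, z * w) \<in> P"
proof -
  have "(0 - y, 1 / w) \<in> P" using assms unfolding circle_hom_graph_def by blast
  then have "(x - (0 - y), z / (1 / w)) \<in> P" using assms unfolding circle_hom_graph_def by blast
  then show ?thesis by simp
qed

lemma circle_hom_graph_int_mult:
  assumes P: "circle_hom_graph P" and xz: "(x, z) \<in> P"
  shows "(int_mult i x, z powi i) \<in> P"
proof -
  have z: "z \<noteq> 0" using assms unfolding circle_hom_graph_def by force
  show ?thesis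
  proof (induction i rule: int_induct[where k = 0])
    case base
    then show ?case using P by (simp add: circle_hom_graph_def)
  next
    case (step1 i)
    then show ?case using circle_hom_graph_add[OF P _ xz] z
      by (simp add: int_mult_succ power_int_add)
  next
    case (step2 i)
    then have "(int_mult i x - x, z powi i / z) \<in> P"
      using P xz unfolding circle_hom_graph_def by blast
    then show ?case using z by (simp add: int_mult_pred power_int_diff)
  qed
qed

text \<open>Divisibility of the circle: divide the argument of \<open>v\<close> by
  \<open>k\<close>.\<close>

lemma exists_circle_root:
  assumes "norm (v :: complex) = 1" "k > 0"
  shows "\<exists>z. norm z = 1 \<and> z ^ k = v"
proof (intro exI conjI)
  show "cis (Arg v / k) ^ k = v"
    using assms rcis_cmod_Arg[of v] by (simp add: Complex.DeMoivre rcis_def)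
qed simp

text \<open>Provides the value that an extension of \<open>P\<close> may take at \<open>x\<close>.
  The integers \<open>i\<close> for which \<open>int_mult i x\<close> lies in the domain of
  \<open>P\<close> form a subgroup of the integers. If it is generated by some \<open>k > 0\<close>,
  any \<open>k\<close>-th root of the value prescribed at \<open>k\<close> works; if it is zero,
  nothing is prescribed.\<close>

lemma exists_compatible_value:
  assumes P: "circle_hom_graph P"
  shows "\<exists>z. norm z = 1 \<and> (\<forall>i v. (int_mult i x, v) \<in> P \<longrightarrow> v = z powi i)"
proof (cases "\<exists>k::nat. k > 0 \<and> (\<exists>v. (int_mult (int k) x, v) \<in> P)")
  case True
  define k where "k = (LEAST k::nat. k > 0 \<and> (\<exists>v. (int_mult (int k) x, v) \<in> P))"
  have "k > 0 \<and> (\<exists>v. (int_mult (int k) x, v) \<in> P)"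
    unfolding k_def using True by (rule LeastI_ex)
  then obtain v where k: "k > 0" and v: "(int_mult (int k) x, v) \<in> P" by blast
  have least: "k \<le> j" if "j > 0" "(int_mult (int j) x, u) \<in> P" for j u
    unfolding k_def using that by (intro Least_le) blast
  have "norm v = 1" using P v unfolding circle_hom_graph_def by blast
  with k obtain z where z: "norm z = 1" "z ^ k = v" using exists_circle_root by metis
  have "u = z powi i" if "(int_mult i x, u) \<in> P" for i u
  proof -
    \<comment> \<open>Division with remainder: the multiple of \<open>x\<close> by \<open>r\<close>
      lies in the domain as well, and \<open>r < k\<close>, so the minimality of \<open>k\<close>
      forces \<open>r = 0\<close>.\<close>
    define q r where "q = i div int k" and "r = nat (i mod int k)"
    have i: "i = q * int k + int r" using k by (simp add: q_def r_def)
    have qk: "(int_mult (q * int k) x, v powi q) \<in> P"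
      using circle_hom_graph_int_mult[OF P v] by (simp add: int_mult_mult)
    then have "(int_mult i x - int_mult (q * int k) x, u / v powi q) \<in> P"
      using P that unfolding circle_hom_graph_def by blast
    then have "(int_mult (int r) x, u / v powi q) \<in> P"
      by (simp flip: int_mult_diff add: i)
    moreover have "r < k" using k by (simp add: r_def nat_less_iff)
    ultimately have "r = 0" using least[of r] by (metis gr0I leD)
    then have "i = q * int k" using i by simp
    then have "u = v powi q"
      using circle_hom_graph_unique[OF P that] qk by blast
    also have "\<dots> = z powi (int k * q)"
      using z(2) by (simp only: power_int_mult power_int_of_nat)
    finally show "u = z powi i"
      using \<open>i = q * int k\<close> by (simp only: mult.commute)
  qed
  with z show ?thesis by blast
next
  case False
  \<comment> \<open>No nonzero multiple of \<open>x\<close> is in the domain, so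
    \<open>i = 0\<close> and every point of the circle would do; 1 is chosen.\<close>
  have "v = 1 powi i" if "(int_mult i x, v) \<in> P" for i v
  proof -
    have "i = 0"
    proof (rule ccontr)
      assume "i \<noteq> 0"
      have "(0 - int_mult i x, 1 / v) \<in> P" using P that unfolding circle_hom_graph_def by blast
      then have "(int_mult (- i) x, 1 / v) \<in> P" using int_mult_diff[of 0 i x] by simp
      then have "\<exists>u. (int_mult \<bar>i\<bar> x, u) \<in> P" using that by (cases "i \<ge> 0") auto
      then show False
        using False \<open>i \<noteq> 0\<close> by (auto dest!: spec[of _ "nat \<bar>i\<bar>"])
    qed
    then show ?thesis using P that by (simp add: circle_hom_graph_def)
  qed
  then show ?thesis by (intro exI[of _ 1]) auto
qed

text \<open>\<open>Q\<close> is the graph of \<open>h + i x \<mapsto> w z^i\<close> on the subgroup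
  generated by the domain of \<open>P\<close> and \<open>x\<close>; the compatibility of
  \<open>z\<close> with \<open>P\<close> is what makes it single-valued.\<close>

lemma circle_hom_graph_extend_point:
  assumes P: "circle_hom_graph P"
  obtains Q z where "circle_hom_graph Q" "P \<subseteq> Q" "(x, z) \<in> Q"
proof -
  obtain z where z: "norm z = 1" "\<And>i v. (int_mult i x, v) \<in> P \<Longrightarrow> v = z powi i"
    using exists_compatible_value[OF P] by metis
  then have z0: "z \<noteq> 0" by auto
  define Q where "Q = {(h + int_mult i x, w * z powi i) | h w i. (h, w) \<in> P}"
  have PQ: "P \<subseteq> Q"
  proof
    fix p assume "p \<in> P"
    then show "p \<in> Q" unfolding Q_def
      by (intro CollectI exI[of _ "fst p"] exI[of _ "snd p"] exI[of _ 0]) auto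
  qed
  have xQ: "(x, z) \<in> Q"
    unfolding Q_def using P
    by (intro CollectI exI[of _ 0] exI[of _ 1]) (auto simp: circle_hom_graph_def)
  have "circle_hom_graph Q"
    unfolding circle_hom_graph_def
  proof (intro conjI allI impI)
    show "(0, 1) \<in> Q" using P PQ by (auto simp: circle_hom_graph_def)
  next
    fix y w assume "(y, w) \<in> Q"
    then show "norm w = 1"
      using P z(1) by (auto simp: Q_def circle_hom_graph_def norm_mult norm_power_int)
  next
    fix y v y' v' assume "(y, v) \<in> Q" "(y', v') \<in> Q"
    then obtain h w i h' w' i' where
      *: "(h, w) \<in> P" "y = h + int_mult i x" "v = w * z powi i"
         "(h', w') \<in> P" "y' = h' + int_mult i' x" "v' = w' * z powi i'"
      unfolding Q_def by blast
    then have "(h - h', w / w') \<in> P" using P unfolding circle_hom_graph_def by blast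
    moreover have "y - y' = (h - h') + int_mult (i - i') x" using * by (simp add: int_mult_diff)
    moreover have "v / v' = w / w' * z powi (i - i')" using * z0 by (simp add: power_int_diff)
    ultimately show "(y - y', v / v') \<in> Q" unfolding Q_def by blast
  next
    fix v assume "(0, v) \<in> Q"
    then obtain h w i where *: "(h, w) \<in> P" "0 = h + int_mult i x" "v = w * z powi i"
      unfolding Q_def by blast
    \<comment> \<open>Here \<open>- h\<close> is a multiple of \<open>x\<close> inside the domain of
      \<open>P\<close>, so \<open>P\<close> and \<open>z\<close> must agree on it.\<close>
    have "(0 - h, 1 / w) \<in> P" using P *(1) unfolding circle_hom_graph_def by blast
    moreover have "0 - h = int_mult i x" using *(2) by (metis add_diff_cancel_left')
    ultimately have "1 / w = z powi i" using z(2) by metis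
    moreover have "w \<noteq> 0" using P *(1) unfolding circle_hom_graph_def by force
    ultimately show "v = 1" using * by (simp add: field_simps)
  qed
  then show thesis using that PQ xQ by blast
qed

text \<open>A graph that is maximal under inclusion is total, since otherwise it could be extended
  by one more point.\<close>

lemma circle_hom_extension:
  fixes P0 :: "('a::ab_group_add \<times> complex) set"
  assumes P0: "circle_hom_graph P0"
  obtains F where "\<And>x. norm (F x) = 1" "\<And>x y. F (x + y) = F x * F y" "\<And>x z. (x, z) \<in> P0 \<Longrightarrow> F x = z"
proof -
  define \<A> where "\<A> = {P. circle_hom_graph P \<and> P0 \<subseteq> P}"
  have "\<exists>U\<in>\<A>. \<forall>X\<in>\<C>. X \<subseteq> U" if "subset.chain \<A> \<C>" for \<C>
  proof (cases "\<C> = {}")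
    case True
    \<comment> \<open>The union of the empty chain is empty and does not contain \<open>P0\<close>,
      so \<open>P0\<close> itself serves as the upper bound.\<close>
    then show ?thesis using P0 by (auto simp: \<A>_def)
  next
    case False
    have C: "circle_hom_graph P" "P0 \<subseteq> P" if "P \<in> \<C>" for P
      using that \<open>subset.chain \<A> \<C>\<close> by (auto simp: subset.chain_def \<A>_def)
    have "circle_hom_graph (\<Union>\<C>)"
      unfolding circle_hom_graph_def
    proof (intro conjI allI impI)
      show "(0, 1) \<in> \<Union>\<C>" using False C by (auto simp: circle_hom_graph_def)
    next
      fix x z y w assume *: "(x, z) \<in> \<Union>\<C>" "(y, w) \<in> \<Union>\<C>"
      then obtain P Q where "P \<in> \<C>" "Q \<in> \<C>" "(x, z) \<in> P" "(y, w) \<in> Q" by blast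
      then obtain R where "R \<in> \<C>" "(x, z) \<in> R" "(y, w) \<in> R"
        using subset_chain_def[of \<A> \<C>] \<open>subset.chain \<A> \<C>\<close> by blast
      then have "(x - y, z / w) \<in> R" using C(1)[of R] unfolding circle_hom_graph_def by blast
      with \<open>R \<in> \<C>\<close> show "(x - y, z / w) \<in> \<Union>\<C>" by blast
    qed (use C in \<open>auto simp: circle_hom_graph_def\<close>)
    moreover have "P0 \<subseteq> \<Union>\<C>" using False C by blast
    ultimately show ?thesis by (intro bexI[of _ "\<Union>\<C>"]) (auto simp: \<A>_def)
  qed
  then have "\<exists>M\<in>\<A>. \<forall>X\<in>\<A>. M \<subseteq> X \<longrightarrow> X = M"
    by (rule subset_Zorn)
  then obtain P where "P \<in> \<A>" and max: "\<And>X. X \<in> \<A> \<Longrightarrow> P \<subseteq> X \<Longrightarrow> X = P"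
    by metis
  then have P: "circle_hom_graph P" "P0 \<subseteq> P" by (auto simp: \<A>_def)
  have total: "\<exists>z. (x, z) \<in> P" for x
  proof -
    obtain Q z where Q: "circle_hom_graph Q" "P \<subseteq> Q" "(x, z) \<in> Q"
      using circle_hom_graph_extend_point[OF P(1)] .
    then have "Q \<in> \<A>" using P(2) by (auto simp: \<A>_def)
    then have "Q = P" using max Q(2) by blast
    with Q(3) show ?thesis by blast
  qed
  define F where "F x = (SOME z. (x, z) \<in> P)" for x
  have F: "(x, F x) \<in> P" for x
    unfolding F_def by (rule someI_ex[OF total])
  show thesis
  proof
    show "norm (F x) = 1" for x using F[of x] P(1) by (auto simp: circle_hom_graph_def)
    show "F (x + y) = F x * F y" for x y
      using circle_hom_graph_unique[OF P(1) F circle_hom_graph_add[OF P(1) F F]] .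
    show "F x = z" if "(x, z) \<in> P0" for x z
      using circle_hom_graph_unique[OF P(1) F] P(2) that by blast
  qed
qed

section \<open>Compact open subgroups\<close>

lemma open_translation_group:
  fixes S :: "'a::topological_ab_group_add set"
  assumes "open S"
  shows "open ((+) a ` S)"
proof -
  have "(+) a ` S = (\<lambda>x. x + (- a)) -` S" by (force simp: image_iff algebra_simps)
  moreover have "open ((\<lambda>x. x + (- a)) -` S)"
    using assms by (intro open_vimage continuous_intros)
  ultimately show ?thesis by simp
qed

lemma compact_translation_group:
  fixes S :: "'a::topological_ab_group_add set"
  assumes "compact S"
  shows "compact ((+) a ` S)"
  using assms by (intro compact_continuous_image continuous_intros)

lemma add_subgroup_open:
  fixes H :: "'a::topological_ab_group_add set"
  assumes H: "add_subgroup H" and "0 \<in> V" "open V" "V \<subseteq> H"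
  shows "open H"
proof (rule Topological_Spaces.openI)
  fix x assume "x \<in> H"
  then show "\<exists>T. open T \<and> x \<in> T \<and> T \<subseteq> H"
    using assms add_subgroup_add[OF H, of x] open_translation_group[of V x]
    by (intro exI[of _ "(+) x ` V"] conjI) (auto intro!: image_eqI[of x _ 0])
qed

lemma add_subgroup_closed:
  fixes H :: "'a::topological_ab_group_add set"
  assumes H: "add_subgroup H" and "open H"
  shows "closed H"
proof -
  have "- H = (\<Union>x\<in>- H. (+) x ` H)"
  proof -
    have "x + h \<notin> H" if "x \<notin> H" "h \<in> H" for x h
      using that add_subgroup_vimage_diff[OF H, of "x + h" x] by simp
    then have "(\<Union>x\<in>- H. (+) x ` H) \<subseteq> - H" by auto
    moreover have "x \<in> (+) x ` H" for x
      using add_subgroup_0[OF H] by (intro image_eqI[of _ _ 0]) auto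
    then have "- H \<subseteq> (\<Union>x\<in>- H. (+) x ` H)" by fast
    ultimately show ?thesis by (rule equalityI[rotated])
  qed
  then have "open (- H)" using assms open_translation_group by (metis open_UN)
  then show ?thesis by (simp add: closed_def)
qed

definition compact_open_subgroup :: "'a::topological_ab_group_add set \<Rightarrow> bool" where
  "compact_open_subgroup H \<longleftrightarrow> add_subgroup H \<and> open H \<and> compact H"

lemma compact_open_subgroup_nhds: "compact_open_subgroup H \<Longrightarrow> H \<in> compact_nhds0"
  by (auto simp: compact_open_subgroup_def compact_nhds0_def add_subgroup_0 interior_open)

lemma compact_open_subgroup_subset:
  assumes "compact_open_subgroup U" "add_subgroup H" "open H" "H \<subseteq> U"
  shows "compact_open_subgroup H"
proof -
  have "compact (U \<inter> H)"
    using assms add_subgroup_closed by (intro compact_Int_closed) (auto simp: compact_open_subgroup_def)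
  then show ?thesis using assms by (simp add: compact_open_subgroup_def Int_absorb1)
qed

text \<open>Since \<open>{x}\<close> is a compact component of a locally compact Hausdorff space, a
  clopen set separates it from any closed set avoiding \<open>x\<close>.\<close>

lemma exists_compact_open_in_nbhd:
  fixes W :: "'a::{topological_space, t2_space} set"
  assumes lc: "locally_compact_space (euclidean :: 'a topology)"
    and td: "totally_disconnected (UNIV :: 'a set)" and W: "open W" "x \<in> W"
  obtains A where "compact A" "open A" "x \<in> A" "A \<subseteq> W"
proof -
  have t2: "Hausdorff_space (euclidean :: 'a topology)"
    using hausdorff by (auto simp: Hausdorff_space_def disjnt_def)
  have "connected_component_of_set euclidean x = connected_component_set UNIV x"
    by (auto simp: connected_component_of_def connected_component_def)
  then have "connected_component_of_set euclidean x = {x}"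
    using td by (simp add: totally_disconnected_def)
  then have comp: "{x} \<in> connected_components_of (euclidean :: 'a topology)"
    by (metis connected_component_in_connected_components_of topspace_euclidean UNIV_I)
  obtain U K where UK: "open U" "compact K" "x \<in> U" "U \<subseteq> K"
    using lc unfolding locally_compact_space_def by (auto dest!: spec[of _ x])
  \<comment> \<open>Separating from the complement of \<open>U \<inter> W\<close>, not just of
    \<open>W\<close>, keeps the clopen set inside the compact \<open>K\<close>, which makes it
    compact.\<close>
  have "separated_between euclidean {x} (- (U \<inter> W))"
    using W UK by (intro separated_between_compact_connected_component[OF lc t2 comp])
      (auto simp: disjnt_def closed_Compl)
  then obtain A where A: "closed A" "open A" "x \<in> A" "- (U \<inter> W) \<subseteq> - A"
    by (auto simp: separated_between Compl_eq_Diff_UNIV)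
  have "compact (K \<inter> A)" using UK A by (intro compact_Int_closed)
  moreover have "K \<inter> A = A" using A UK by auto
  ultimately show thesis using that A by auto
qed

text \<open>The subgroup is the stabiliser of a compact open set under translation.\<close>

lemma van_Dantzig:
  fixes W :: "'a::{topological_ab_group_add, t2_space} set"
  assumes lc: "locally_compact_space (euclidean :: 'a topology)"
    and td: "totally_disconnected (UNIV :: 'a set)" and W: "open W" "0 \<in> W"
  obtains H where "compact_open_subgroup H" "H \<subseteq> W"
proof -
  obtain A where A: "compact A" "open A" "0 \<in> A" "A \<subseteq> W"
    using exists_compact_open_in_nbhd[OF lc td W] .
  define H where "H = {x. \<forall>y. x + y \<in> A \<longleftrightarrow> y \<in> A}"
  have H: "add_subgroup H"
    unfolding add_subgroup_def
  proof (intro conjI ballI)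
    fix x y assume "x \<in> H" "y \<in> H"
    then have "x + (z - y) \<in> A \<longleftrightarrow> z - y \<in> A" "y + (z - y) \<in> A \<longleftrightarrow> z - y \<in> A" for z
      unfolding H_def by blast+
    moreover have "x - y + z = x + (z - y)" "y + (z - y) = z" for z
      by (simp_all add: algebra_simps)
    ultimately have "x - y + z \<in> A \<longleftrightarrow> z \<in> A" for z
      by metis
    then show "x - y \<in> H" by (simp add: H_def)
  qed (simp add: H_def)
  have "H \<subseteq> A"
  proof
    fix x assume "x \<in> H"
    then have "x + 0 \<in> A \<longleftrightarrow> 0 \<in> A" unfolding H_def by blast
    with A(3) show "x \<in> A" by simp
  qed
  \<comment> \<open>A tube argument: continuity of addition gives a neighbourhood of 0 for each
    point of \<open>A\<close>, and compactness of \<open>A\<close> leaves finitely many to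
    intersect.\<close>
  have "\<exists>V. open V \<and> 0 \<in> V \<and> (\<forall>v\<in>V. \<forall>a\<in>A. v + a \<in> A)"
  proof -
    have "\<exists>V N. open V \<and> 0 \<in> V \<and> open N \<and> a \<in> N \<and> (\<forall>v\<in>V. \<forall>y\<in>N. v + y \<in> A)" if "a \<in> A" for a
    proof -
      have "open ((\<lambda>p. fst p + snd p) -` A)"
        using A(2) by (intro open_vimage continuous_intros)
      moreover have "(0, a) \<in> (\<lambda>p. fst p + snd p) -` A" using that by simp
      ultimately obtain V N where "open V" "open N" "(0, a) \<in> V \<times> N"
        "V \<times> N \<subseteq> (\<lambda>p. fst p + snd p) -` A"
        by (rule open_prod_elim)
      then show ?thesis by (intro exI[of _ V] exI[of _ N]) auto
    qed
    then obtain V N where VN: "\<And>a. a \<in> A \<Longrightarrow> open (V a) \<and> 0 \<in> V a \<and> open (N a) \<and> a \<in> N a \<and>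
      (\<forall>v\<in>V a. \<forall>y\<in>N a. v + y \<in> A)" by metis
    have "A \<subseteq> (\<Union>a\<in>A. N a)" using VN by blast
    then obtain D where D: "D \<subseteq> A" "finite D" "A \<subseteq> (\<Union>a\<in>D. N a)"
      using compactE_image[OF A(1), of A N] VN by metis
    then have "open (\<Inter>a\<in>D. V a)" "0 \<in> (\<Inter>a\<in>D. V a)" using VN by auto
    moreover have "\<forall>v\<in>(\<Inter>a\<in>D. V a). \<forall>a\<in>A. v + a \<in> A" using D VN by blast
    ultimately show ?thesis by blast
  qed
  then obtain V where V: "open V" "0 \<in> V" "\<And>v a. v \<in> V \<Longrightarrow> a \<in> A \<Longrightarrow> v + a \<in> A" by blast
  have "open (uminus -` V)" using V(1) by (intro open_vimage continuous_intros)
  moreover have "V \<inter> uminus -` V \<subseteq> H"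
  proof
    fix v assume v: "v \<in> V \<inter> uminus -` V"
    then have "v + y \<in> A \<longleftrightarrow> y \<in> A" for y
      using V(3)[of v y] V(3)[of "- v" "v + y"] by auto
    then show "v \<in> H" by (simp add: H_def)
  qed
  ultimately have "open H"
    using V by (intro add_subgroup_open[OF H, of "V \<inter> uminus -` V"]) auto
  have "compact (A \<inter> H)"
    using A add_subgroup_closed[OF H \<open>open H\<close>] by (intro compact_Int_closed)
  then show thesis
    using that[of H] H \<open>open H\<close> \<open>H \<subseteq> A\<close> A(4) by (auto simp: compact_open_subgroup_def Int_absorb1)
qed

section \<open>Annihilators\<close>

lemma char_of_0 [simp]: "char_of \<xi> 0 = 1"
  using char_of_add[of \<xi> 0 0] by simp

lemma char_of_uminus: "char_of \<xi> (- x) = inverse (char_of \<xi> x)"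
  using char_of_add[of \<xi> x "- x"] by (simp add: field_simps)

lemma char_of_diff: "char_of \<xi> (x - y) = char_of \<xi> x / char_of \<xi> y"
  using char_of_add[of \<xi> x "- y"] by (simp add: char_of_uminus field_simps)

lemma char_of_minus_dual: "char_of (\<xi> - \<zeta>) x = char_of \<xi> x / char_of \<zeta> x"
  unfolding minus_dual_def plus_dual.rep_eq uminus_dual.rep_eq by (simp add: divide_inverse)

definition annihilator :: "'a::topological_ab_group_add set \<Rightarrow> 'a dual set" where
  "annihilator H = {\<xi>. \<forall>x\<in>H. char_of \<xi> x = 1}"

lemma add_subgroup_annihilator: "add_subgroup (annihilator H)"
  by (auto simp: add_subgroup_def annihilator_def zero_dual.rep_eq char_of_minus_dual)

lemma annihilator_antimono: "H \<subseteq> K \<Longrightarrow> annihilator K \<subseteq> annihilator H"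
  by (auto simp: annihilator_def)

text \<open>The circle has no small subgroups: doubling \<open>x\<close> at least doubles \<open>1 - Re (\<xi> x)\<close> as long as
  the values stay in the right half plane.\<close>

lemma annihilatorI_Re_pos:
  fixes H :: "'a::topological_ab_group_add set"
  assumes H: "add_subgroup H" and pos: "\<And>x. x \<in> H \<Longrightarrow> Re (char_of \<xi> x) > 0"
  shows "\<xi> \<in> annihilator H"
proof -
  have circ: "(Re (char_of \<xi> x))\<^sup>2 + (Im (char_of \<xi> x))\<^sup>2 = 1" for x
    by (metis cmod_power2 norm_char_of power_one)
  have bound: "2 ^ n * (1 - Re (char_of \<xi> x)) < 1" if "x \<in> H" for n x
    using that
  proof (induction n arbitrary: x)
    case 0
    then show ?case using pos by simp
  next
    case (Suc n)
    define c where "c = Re (char_of \<xi> x)"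
    have c: "c > 0" using pos Suc.prems by (simp add: c_def)
    have "c\<^sup>2 \<le> 1" using circ[of x] by (metis c_def le_add_same_cancel1 zero_le_power2)
    then have c1: "c \<le> 1" using c by (simp add: abs_square_le_1)
    have double: "Re (char_of \<xi> (x + x)) = 2 * c\<^sup>2 - 1"
      using circ[of x] by (simp add: char_of_add c_def power2_eq_square)
    \<comment> \<open>The difference of the two sides is \<open>2 * c * (1 - c)\<close>.\<close>
    have "2 * (1 - c) \<le> 1 - (2 * c\<^sup>2 - 1)"
      using mult_nonneg_nonneg[of c "1 - c"] c c1 by (simp add: power2_eq_square algebra_simps)
    then have "2 ^ n * (2 * (1 - c)) \<le> 2 ^ n * (1 - (2 * c\<^sup>2 - 1))"
      by (intro mult_left_mono) auto
    also have "\<dots> < 1"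
      using Suc add_subgroup_add[OF H] unfolding double[symmetric] by blast
    finally have "2 ^ n * (2 * (1 - c)) < 1" .
    then show ?case unfolding c_def[symmetric] by (simp add: algebra_simps)
  qed
  have "char_of \<xi> x = 1" if x: "x \<in> H" for x
  proof -
    have "Re (char_of \<xi> x) \<ge> 1"
    proof (rule ccontr)
      assume "\<not> ?thesis"
      then have d: "1 - Re (char_of \<xi> x) > 0" by simp
      obtain n where "1 / (1 - Re (char_of \<xi> x)) < 2 ^ n"
        using real_arch_pow[of 2 "1 / (1 - Re (char_of \<xi> x))"] by auto
      then have "1 < 2 ^ n * (1 - Re (char_of \<xi> x))" using d by (simp add: field_simps)
      then show False using bound[OF x, of n] by simp
    qed
    moreover have "Re (char_of \<xi> x) \<le> 1" using complex_Re_le_cmod[of "char_of \<xi> x"] by simp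
    ultimately have "Re (char_of \<xi> x) = 1" by simp
    then show ?thesis using circ[of x] by (simp add: complex_eq_iff)
  qed
  then show ?thesis by (simp add: annihilator_def)
qed

text \<open>For a subgroup, the open condition of positive real part already forces the value 1, so
  the annihilator is a subbasic set of the compact-open topology.\<close>

lemma open_annihilator:
  fixes H :: "'a::topological_ab_group_add set"
  assumes H: "add_subgroup H" "compact H"
  shows "open (annihilator H)"
proof -
  have "annihilator H = {\<xi>. char_of \<xi> ` H \<subseteq> {z. Re z > 0}}"
    using annihilatorI_Re_pos[OF H(1)] by (auto simp: annihilator_def)
  moreover have "open {z. Re z > 0}" by (rule open_halfspace_Re_gt)
  ultimately show ?thesis
    unfolding open_dual_def using H(2) by (intro generate_topology.Basis) blast
qed

text \<open>\<open>f\<close> is constant on the translates of \<open>H\<close>, so even the preimage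
  of an arbitrary set is open.\<close>

lemma circle_hom_is_character:
  fixes f :: "'a::topological_ab_group_add \<Rightarrow> complex"
  assumes H: "open H" "0 \<in> H"
    and f: "\<And>x. norm (f x) = 1" "\<And>x y. f (x + y) = f x * f y" "\<And>x. x \<in> H \<Longrightarrow> f x = 1"
  shows "is_character f"
proof -
  have "open (f -` B)" for B
  proof (rule Topological_Spaces.openI)
    fix x assume "x \<in> f -` B"
    then show "\<exists>T. open T \<and> x \<in> T \<and> T \<subseteq> f -` B"
      using open_translation_group[OF H(1), of x] H(2) f
      by (intro exI[of _ "(+) x ` H"] conjI image_eqI[of x _ 0]) auto
  qed
  then show ?thesis using f(1,2) by (auto simp: is_character_def continuous_on_open_vimage)
qed

lemma compact_cover_cosets:
  fixes H :: "'a::topological_ab_group_add set"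
  assumes "compact K" "open H" "0 \<in> H"
  obtains D where "finite D" "K \<subseteq> (\<Union>a\<in>D. (+) a ` H)"
proof -
  have "x \<in> (+) x ` H" for x using assms(3) by (intro image_eqI[of _ _ 0]) auto
  then have "K \<subseteq> (\<Union>a\<in>K. (+) a ` H)" by fast
  then show thesis
    using compactE_image[OF assms(1), of K "\<lambda>a. (+) a ` H"] open_translation_group[OF assms(2)] that
    by metis
qed

text \<open>On the annihilator of an open subgroup the compact-open topology is the topology of pointwise
  convergence, so that Tychonoff's theorem applies.\<close>

lemma compact_annihilator:
  fixes H :: "'a::topological_ab_group_add set"
  assumes H: "add_subgroup H" "open H"
  shows "compact (annihilator H)"
proof -
  define P where "P = {f :: 'a \<Rightarrow> complex. \<forall>x y. f (x + y) = f x * f y} \<inter> {f. \<forall>x. x \<in> H \<longrightarrow> f x = 1}"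
  define S where "S = PiE (UNIV :: 'a set) (\<lambda>_. sphere (0 :: complex) 1)"
  have coord: "continuous_on A (\<lambda>f :: 'a \<Rightarrow> complex. f x)" for A x
    using continuous_on_product_coordinates[of x] continuous_on_subset by blast
  have "compactin (product_topology (\<lambda>_. euclidean) UNIV) S"
    unfolding S_def by (simp add: compactin_PiE)
  then have "compact S" by (simp add: euclidean_product_topology)
  moreover have "closed P"
    unfolding P_def
    by (intro closed_Int closed_Collect_all closed_Collect_imp closed_Collect_eq open_Collect_const
        continuous_intros coord)
  ultimately have "compact (S \<inter> P)" by (rule compact_Int_closed)
  \<comment> \<open>Continuity is not a closed condition on functions, but triviality on the open
    \<open>H\<close> is one and implies it.\<close>
  have char: "is_character f" if "f \<in> S \<inter> P" for f
    using that add_subgroup_0[OF H(1)] by (intro circle_hom_is_character[OF H(2)]) (auto simp: S_def P_def)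
  have "annihilator H = Abs_dual ` (S \<inter> P)"
  proof (intro equalityI subsetI)
    fix \<xi> assume "\<xi> \<in> annihilator H"
    then have "char_of \<xi> \<in> S \<inter> P"
      by (auto simp: annihilator_def S_def P_def char_of_add)
    then show "\<xi> \<in> Abs_dual ` (S \<inter> P)" by (metis char_of_inverse image_eqI)
  next
    fix \<xi> assume "\<xi> \<in> Abs_dual ` (S \<inter> P)"
    then obtain f where f: "f \<in> S \<inter> P" "\<xi> = Abs_dual f" by blast
    then have "char_of \<xi> = f" using char by (simp add: Abs_dual_inverse)
    then show "\<xi> \<in> annihilator H" using f by (simp add: annihilator_def P_def)
  qed
  moreover have "continuous_on (S \<inter> P) Abs_dual"
    unfolding continuous_on_def
  proof
    fix f assume f: "f \<in> S \<inter> P"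
    show "(Abs_dual \<longlongrightarrow> Abs_dual f) (at f within S \<inter> P)"
      unfolding tendsto_dual_iff
    proof (intro allI impI uniform_limitI)
      fix K :: "'a set" and e :: real assume "compact K" "e > 0"
      \<comment> \<open>All functions in \<open>S \<inter> P\<close> are constant on cosets of
        \<open>H\<close>, so closeness at the finitely many points of \<open>D\<close> is uniform
        closeness on \<open>K\<close>.\<close>
      obtain D where D: "finite D" "K \<subseteq> (\<Union>a\<in>D. (+) a ` H)"
        using compact_cover_cosets[OF \<open>compact K\<close> H(2) add_subgroup_0[OF H(1)]] .
      have "\<forall>\<^sub>F g in at f within S \<inter> P. dist (g a) (f a) < e" for a
        using coord[of "S \<inter> P" a] f \<open>e > 0\<close> by (auto simp: continuous_on_def intro: tendstoD)
      then have "\<forall>\<^sub>F g in at f within S \<inter> P. \<forall>a\<in>D. dist (g a) (f a) < e"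
        using D(1) by (intro eventually_ball_finite) auto
      moreover have "\<forall>\<^sub>F g in at f within S \<inter> P. g \<in> S \<inter> P"
        by (simp add: eventually_at_filter)
      ultimately show "\<forall>\<^sub>F g in at f within S \<inter> P.
          \<forall>x\<in>K. dist (char_of (Abs_dual g) x) (char_of (Abs_dual f) x) < e"
      proof eventually_elim
        case (elim g)
        show ?case
        proof
          fix x assume "x \<in> K"
          then obtain a h where x: "a \<in> D" "h \<in> H" "x = a + h" using D(2) by blast
          then have "g x = g a" "f x = f a" using elim(2) f by (auto simp: P_def)
          then show "dist (char_of (Abs_dual g) x) (char_of (Abs_dual f) x) < e"
            using elim x(1) f char by (simp add: Abs_dual_inverse)
        qed
      qed
    qed
  qed
  ultimately show ?thesis
    using compact_continuous_image[OF _ \<open>compact (S \<inter> P)\<close>] by simp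
qed

lemma compact_open_subgroup_annihilator:
  "compact_open_subgroup H \<Longrightarrow> compact_open_subgroup (annihilator H)"
  by (simp add: compact_open_subgroup_def add_subgroup_annihilator open_annihilator compact_annihilator)

text \<open>Take a compact open subgroup on which the character has positive real part; having no
  small subgroups, the circle leaves only the trivial image.\<close>

lemma character_in_annihilator:
  fixes \<xi> :: "'a::{topological_ab_group_add, t2_space} dual"
  assumes lc: "locally_compact_space (euclidean :: 'a topology)"
    and td: "totally_disconnected (UNIV :: 'a set)"
  shows "\<exists>H. compact_open_subgroup H \<and> \<xi> \<in> annihilator H"
proof -
  have "open (char_of \<xi> -` {z. Re z > 0})"
    using continuous_char_of open_halfspace_Re_gt by (intro open_vimage)
  moreover have "0 \<in> char_of \<xi> -` {z. Re z > 0}" by simp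
  ultimately obtain H where H: "compact_open_subgroup H" "H \<subseteq> char_of \<xi> -` {z. Re z > 0}"
    by (rule van_Dantzig[OF lc td])
  then have "\<xi> \<in> annihilator H"
    by (intro annihilatorI_Re_pos) (auto simp: compact_open_subgroup_def)
  with H(1) show ?thesis by blast
qed

lemma compact_subset_annihilator:
  fixes K :: "'a::{topological_ab_group_add, t2_space} dual set"
  assumes lc: "locally_compact_space (euclidean :: 'a topology)"
    and td: "totally_disconnected (UNIV :: 'a set)" and K: "compact K"
  obtains H where "compact_open_subgroup H" "K \<subseteq> annihilator H"
proof -
  obtain H where H: "\<And>\<xi> :: 'a dual. compact_open_subgroup (H \<xi>) \<and> \<xi> \<in> annihilator (H \<xi>)"
    using character_in_annihilator[OF lc td] by metis
  then have "open (annihilator (H \<xi>))" for \<xi>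
    by (simp add: compact_open_subgroup_def open_annihilator)
  moreover have "K \<subseteq> (\<Union>\<xi>\<in>K. annihilator (H \<xi>))" using H by blast
  ultimately obtain D where D: "finite D" "K \<subseteq> (\<Union>\<xi>\<in>D. annihilator (H \<xi>))"
    using compactE_image[OF K, of K "\<lambda>\<xi>. annihilator (H \<xi>)"] by metis
  \<comment> \<open>Intersecting with \<open>H 0\<close> keeps \<open>L\<close> compact even if
    \<open>D\<close> is empty.\<close>
  define L where "L = H 0 \<inter> (\<Inter>\<xi>\<in>D. H \<xi>)"
  have "compact_open_subgroup L"
  proof (rule compact_open_subgroup_subset)
    show "compact_open_subgroup (H 0)" using H by blast
    show "add_subgroup L"
      using H unfolding L_def compact_open_subgroup_def add_subgroup_def by blast
    show "open L"
      unfolding L_def using H D(1) by (intro open_Int open_INT) (auto simp: compact_open_subgroup_def)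
  qed (simp add: L_def)
  moreover have "annihilator (H \<xi>) \<subseteq> annihilator L" if "\<xi> \<in> D" for \<xi>
    using that by (intro annihilator_antimono) (auto simp: L_def)
  then have "K \<subseteq> annihilator L" using D(2) by blast
  ultimately show thesis using that by blast
qed

section \<open>Endomorphisms and the annihilators of cotrajectories\<close>

lemma continuous_endo_add: "continuous_endo \<phi> \<Longrightarrow> \<phi> (x + y) = \<phi> x + \<phi> y"
  by (simp add: continuous_endo_def Modules.additive_def)

lemma continuous_endo_diff: "continuous_endo \<phi> \<Longrightarrow> \<phi> (x - y) = \<phi> x - \<phi> y"
  using continuous_endo_add[of \<phi> "x - y" y] by simp

lemma continuous_endo_0: "continuous_endo \<phi> \<Longrightarrow> \<phi> 0 = 0"
  using continuous_endo_diff[of \<phi> 0 0] by simp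

lemma add_subgroup_vimage:
  assumes "continuous_endo \<phi>" "add_subgroup H"
  shows "add_subgroup (\<phi> -` H)"
  using assms by (auto simp: add_subgroup_def continuous_endo_0 continuous_endo_diff)

lemma add_subgroup_Int: "add_subgroup H \<Longrightarrow> add_subgroup K \<Longrightarrow> add_subgroup (H \<inter> K)"
  by (auto simp: add_subgroup_def)

text \<open>A character \<open>\<eta>\<close> trivial on \<open>U \<inter> \<psi>\<^sup>-\<^sup>1(V)\<close> induces the homomorphism \<open>\<psi> u + v \<mapsto> \<eta> u\<close> on
  \<open>\<psi>(U) + V\<close>. Every extension of it to the whole group is trivial on the open subgroup \<open>V\<close>, hence
  continuous.\<close>

lemma annihilator_Int_vimage:
  fixes U V :: "'a::topological_ab_group_add set"
  assumes \<psi>: "continuous_endo \<psi>" and U: "add_subgroup U" and V: "add_subgroup V" "open V"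
  shows "annihilator (U \<inter> \<psi> -` V) = annihilator U + dual_endo \<psi> ` annihilator V"
proof (intro equalityI subsetI)
  fix \<eta> assume "\<eta> \<in> annihilator U + dual_endo \<psi> ` annihilator V"
  then obtain a b where "a \<in> annihilator U" "b \<in> annihilator V" "\<eta> = a + dual_endo \<psi> b"
    by (auto elim!: set_plus_elim)
  then show "\<eta> \<in> annihilator (U \<inter> \<psi> -` V)"
    by (simp add: annihilator_def plus_dual.rep_eq char_of_dual_endo[OF \<psi>])
next
  fix \<eta> assume \<eta>: "\<eta> \<in> annihilator (U \<inter> \<psi> -` V)"
  define P where "P = {(\<psi> u + v, char_of \<eta> u) | u v. u \<in> U \<and> v \<in> V}"
  have P: "(x, z) \<in> P \<longleftrightarrow> (\<exists>u v. u \<in> U \<and> v \<in> V \<and> x = \<psi> u + v \<and> z = char_of \<eta> u)" for x z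
    by (auto simp: P_def)
  have "circle_hom_graph P"
    unfolding circle_hom_graph_def
  proof (intro conjI allI impI)
    show "(0, 1) \<in> P"
      unfolding P using add_subgroup_0[OF U] add_subgroup_0[OF V(1)] continuous_endo_0[OF \<psi>]
      by (intro exI[of _ 0]) simp
  next
    fix x z y w assume "(x, z) \<in> P" "(y, w) \<in> P"
    then obtain u v u' v' where *: "u \<in> U" "v \<in> V" "x = \<psi> u + v" "z = char_of \<eta> u"
      "u' \<in> U" "v' \<in> V" "y = \<psi> u' + v'" "w = char_of \<eta> u'"
      unfolding P by blast
    then have "x - y = \<psi> (u - u') + (v - v')" "z / w = char_of \<eta> (u - u')" "u - u' \<in> U" "v - v' \<in> V"
      using add_subgroup_diff[OF U] add_subgroup_diff[OF V(1)]
      by (auto simp: continuous_endo_diff[OF \<psi>] char_of_diff)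
    then show "(x - y, z / w) \<in> P" unfolding P by blast
  next
    fix z assume "(0, z) \<in> P"
    then obtain u v where *: "u \<in> U" "v \<in> V" "0 = \<psi> u + v" "z = char_of \<eta> u"
      unfolding P by blast
    then have "\<psi> u = - v" by (simp add: eq_neg_iff_add_eq_0)
    then have "u \<in> U \<inter> \<psi> -` V" using * add_subgroup_uminus[OF V(1)] by simp
    then show "z = 1" using \<eta> * by (simp add: annihilator_def)
  qed (auto simp: P)
  then obtain F where F: "\<And>x. norm (F x) = 1" "\<And>x y. F (x + y) = F x * F y" "\<And>x z. (x, z) \<in> P \<Longrightarrow> F x = z"
    using circle_hom_extension by metis
  have FV: "F v = 1" if "v \<in> V" for v
    using that add_subgroup_0[OF U] continuous_endo_0[OF \<psi>]
    by (intro F(3), unfold P, intro exI[of _ 0] exI[of _ v]) simp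
  have FU: "F (\<psi> u) = char_of \<eta> u" if "u \<in> U" for u
    using that add_subgroup_0[OF V(1)]
    by (intro F(3), unfold P, intro exI[of _ u] exI[of _ 0]) simp
  have "is_character F"
    using F FV add_subgroup_0[OF V(1)] by (intro circle_hom_is_character[OF V(2)]) auto
  then have b: "char_of (Abs_dual F) = F" by (simp add: Abs_dual_inverse)
  have "Abs_dual F \<in> annihilator V" using FV by (simp add: annihilator_def b)
  moreover have "\<eta> - dual_endo \<psi> (Abs_dual F) \<in> annihilator U"
    using FU by (simp add: annihilator_def char_of_minus_dual char_of_dual_endo[OF \<psi>] b)
  ultimately have "(\<eta> - dual_endo \<psi> (Abs_dual F)) + dual_endo \<psi> (Abs_dual F)
      \<in> annihilator U + dual_endo \<psi> ` annihilator V"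
    by (intro set_plus_intro imageI)
  then show "\<eta> \<in> annihilator U + dual_endo \<psi> ` annihilator V" by simp
qed

lemma continuous_endo_funpow:
  assumes "continuous_endo \<phi>"
  shows "continuous_endo (\<phi> ^^ n)"
proof (induction n)
  case 0
  show ?case by (simp add: continuous_endo_def Modules.additive_def)
next
  case (Suc n)
  then have "continuous_on UNIV (\<phi> \<circ> (\<phi> ^^ n))"
    using assms by (intro continuous_on_compose) (auto simp: continuous_endo_def intro: continuous_on_subset)
  then show ?case using Suc assms by (simp add: continuous_endo_def Modules.additive_def comp_def)
qed

lemma dual_endo_funpow:
  assumes \<phi>: "continuous_endo \<phi>"
  shows "dual_endo \<phi> ^^ n = dual_endo (\<phi> ^^ n)"
proof (induction n)
  case 0
  have "continuous_endo (id :: 'a \<Rightarrow> 'a)" using continuous_endo_funpow[OF \<phi>, of 0] by simp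
  then have "char_of (dual_endo id \<xi>) = char_of \<xi>" for \<xi> :: "'a dual"
    by (simp only: char_of_dual_endo comp_id)
  then have "dual_endo id = (id :: 'a dual \<Rightarrow> 'a dual)" by (metis char_of_inject eq_id_iff)
  then show ?case by (simp only: funpow.simps)
next
  case (Suc n)
  \<comment> \<open>Dualising reverses composition, so the new factor \<open>\<phi>\<close> is the
    one applied first; hence \<open>funpow_Suc_right\<close>.\<close>
  have "char_of (dual_endo \<phi> (dual_endo (\<phi> ^^ n) \<xi>)) = char_of (dual_endo (\<phi> ^^ Suc n) \<xi>)" for \<xi>
    using char_of_dual_endo[OF continuous_endo_funpow[OF \<phi>, of n]] \<phi>
      char_of_dual_endo[OF continuous_endo_funpow[OF \<phi>, of "Suc n"]]
    by (simp add: char_of_dual_endo comp_assoc funpow_Suc_right del: funpow.simps)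
  then have "dual_endo \<phi> \<circ> dual_endo (\<phi> ^^ n) = dual_endo (\<phi> ^^ Suc n)"
    unfolding char_of_inject by (simp only: fun_eq_iff comp_apply) simp
  with Suc show ?case by (simp only: funpow.simps)
qed

lemma cotrajectory_0: "cotrajectory \<phi> U 0 = UNIV"
  by (simp add: cotrajectory_def)

lemma cotrajectory_Suc: "cotrajectory \<phi> U (Suc n) = cotrajectory \<phi> U n \<inter> (\<phi> ^^ n) -` U"
  by (auto simp: cotrajectory_def lessThan_Suc)

lemma trajectory_0: "trajectory \<phi> U 0 = {0}"
  by (simp add: trajectory_def)

lemma trajectory_Suc: "trajectory \<phi> U (Suc n) = trajectory \<phi> U n + (\<phi> ^^ n) ` U"
  by (simp add: trajectory_def)

lemma add_subgroup_cotrajectory: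
  assumes "continuous_endo \<phi>" "add_subgroup U"
  shows "add_subgroup (cotrajectory \<phi> U n)"
proof (induction n)
  case 0
  show ?case by (simp add: cotrajectory_0 add_subgroup_def)
next
  case (Suc n)
  then show ?case
    using add_subgroup_vimage[OF continuous_endo_funpow[OF assms(1), of n] assms(2)]
    by (simp add: cotrajectory_Suc add_subgroup_Int)
qed

lemma open_cotrajectory:
  assumes "continuous_endo \<phi>" "open U"
  shows "open (cotrajectory \<phi> U n)"
  unfolding cotrajectory_def using assms continuous_endo_funpow[OF assms(1)]
  by (intro open_INT ballI open_vimage) (auto simp: continuous_endo_def)

text \<open>By \<open>annihilator_Int_vimage\<close>, each further intersection with a preimage
  becomes one further summand. The induction can start at 0 because only the zero character
  annihilates the whole group.\<close>

lemma annihilator_cotrajectory: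
  assumes \<phi>: "continuous_endo \<phi>" and U: "add_subgroup U" "open U"
  shows "annihilator (cotrajectory \<phi> U n) = trajectory (dual_endo \<phi>) (annihilator U) n"
proof (induction n)
  case 0
  have "\<xi> = 0" if "\<xi> \<in> annihilator UNIV" for \<xi> :: "'a dual"
    using that by (auto simp: annihilator_def zero_dual.rep_eq simp flip: char_of_inject)
  then show ?case
    using add_subgroup_0[OF add_subgroup_annihilator[of UNIV]] by (auto simp: cotrajectory_0 trajectory_0)
next
  case (Suc n)
  then show ?case
    using annihilator_Int_vimage[OF continuous_endo_funpow[OF \<phi>, of n] add_subgroup_cotrajectory[OF \<phi> U(1)] U]
    by (simp add: cotrajectory_Suc trajectory_Suc dual_endo_funpow[OF \<phi>])
qed

section \<open>Haar measure\<close>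

lemma
  assumes "haar_measure \<mu>"
  shows haar_measure_sets: "sets \<mu> = sets borel"
    and haar_measure_UNIV: "emeasure \<mu> UNIV \<noteq> 0"
    and haar_measure_emeasure_translate: "A \<in> sets borel \<Longrightarrow> emeasure \<mu> ((+) x ` A) = emeasure \<mu> A"
    and haar_measure_compact: "compact K \<Longrightarrow> emeasure \<mu> K < top"
    and haar_measure_inner_regular:
      "open V \<Longrightarrow> emeasure \<mu> V = (SUP K\<in>{K. compact K \<and> K \<subseteq> V}. emeasure \<mu> K)"
proof -
  note * = assms[unfolded haar_measure_def infinity_ennreal_def]
  show "sets \<mu> = sets borel" "emeasure \<mu> UNIV \<noteq> 0" by (rule *[THEN conjunct1] *[THEN conjunct2, THEN conjunct1])+
  show "emeasure \<mu> ((+) x ` A) = emeasure \<mu> A" if "A \<in> sets borel"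
    using *[THEN conjunct2, THEN conjunct2, THEN conjunct1] that by blast
  show "emeasure \<mu> K < top" if "compact K"
    using *[THEN conjunct2, THEN conjunct2, THEN conjunct2, THEN conjunct1] that by blast
  show "emeasure \<mu> V = (SUP K\<in>{K. compact K \<and> K \<subseteq> V}. emeasure \<mu> K)" if "open V"
    using *[THEN conjunct2, THEN conjunct2, THEN conjunct2, THEN conjunct2, THEN conjunct2] that by blast
qed

lemma haar_measure_translate:
  "haar_measure \<mu> \<Longrightarrow> A \<in> sets borel \<Longrightarrow> measure \<mu> ((+) x ` A) = measure \<mu> A"
  by (simp add: haar_measure_emeasure_translate measure_def)

lemma haar_measure_fmeasurable:
  fixes \<mu> :: "'a::{topological_ab_group_add, t2_space} measure"
  assumes "haar_measure \<mu>" "compact K"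
  shows "K \<in> fmeasurable \<mu>"
  using assms by (intro fmeasurableI) (simp_all add: haar_measure_sets borel_compact haar_measure_compact)

lemma haar_measure_mono:
  fixes \<mu> :: "'a::{topological_ab_group_add, t2_space} measure"
  assumes "haar_measure \<mu>" "compact A" "compact B" "A \<subseteq> B"
  shows "measure \<mu> A \<le> measure \<mu> B"
  using assms haar_measure_fmeasurable by (intro measure_mono_fmeasurable) (auto dest: fmeasurableD)

text \<open>Finitely many translates of \<open>V\<close> cover any given compact set. If
  \<open>V\<close> were null, all compact sets would be null and, by inner regularity, so would be
  the whole group.\<close>

lemma haar_measure_open_pos:
  fixes V :: "'a::topological_ab_group_add set"
  assumes \<mu>: "haar_measure \<mu>" and V: "open V" "0 \<in> V"
  shows "emeasure \<mu> V \<noteq> 0"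
proof
  assume 0: "emeasure \<mu> V = 0"
  have meas: "open W \<Longrightarrow> W \<in> sets \<mu>" for W
    using \<mu> by (simp add: haar_measure_sets)
  have "emeasure \<mu> K = 0" if K: "compact K" for K
  proof -
    obtain D where D: "finite D" "K \<subseteq> (\<Union>a\<in>D. (+) a ` V)"
      using compact_cover_cosets[OF K V] .
    have "(+) a ` V \<in> null_sets \<mu>" for a
      using 0 \<mu> V meas open_translation_group[OF V(1)]
      by (simp add: haar_measure_emeasure_translate null_sets_def)
    then have "(\<Union>a\<in>D. (+) a ` V) \<in> null_sets \<mu>" using D(1) by (intro null_sets.finite_UN) auto
    then show ?thesis using D(2) by (metis emeasure_mono le_zero_eq null_setsD1 null_setsD2)
  qed
  then have "emeasure \<mu> UNIV \<le> 0"
    unfolding haar_measure_inner_regular[OF \<mu> open_UNIV] by (intro SUP_least) simp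
  then show False using haar_measure_UNIV[OF \<mu>] by simp
qed

lemma haar_measure_pos:
  fixes \<mu> :: "'a::{topological_ab_group_add, t2_space} measure"
  assumes \<mu>: "haar_measure \<mu>" and U: "U \<in> compact_nhds0"
  shows "measure \<mu> U > 0"
proof -
  have "U \<in> fmeasurable \<mu>" using haar_measure_fmeasurable[OF \<mu>] U by (simp add: compact_nhds0_def)
  moreover have "emeasure \<mu> (interior U) \<noteq> 0"
    using haar_measure_open_pos[OF \<mu>] U by (auto simp: compact_nhds0_def)
  moreover have "emeasure \<mu> (interior U) \<le> emeasure \<mu> U"
    using calculation(1) interior_subset by (intro emeasure_mono) auto
  ultimately show ?thesis
    by (metis emeasure_eq_measure2 ennreal_0 le_zero_eq measure_nonneg order_le_less)
qed

lemma compact_open_subgroup_measure_pos: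
  fixes \<mu> :: "'a::{topological_ab_group_add, t2_space} measure"
  shows "haar_measure \<mu> \<Longrightarrow> compact_open_subgroup U \<Longrightarrow> measure \<mu> U > 0"
  using haar_measure_pos compact_open_subgroup_nhds by blast

text \<open>Representatives that are pairwise incongruent modulo \<open>H\<close> give disjoint
  translates of equal measure; this turns an index into a ratio of measures.\<close>

lemma haar_measure_cosets:
  fixes \<mu> :: "'a::{topological_ab_group_add, t2_space} measure"
  assumes \<mu>: "haar_measure \<mu>" and H: "add_subgroup H" "compact H" and J: "finite J"
    and t: "\<And>i j. i \<in> J \<Longrightarrow> j \<in> J \<Longrightarrow> i \<noteq> j \<Longrightarrow> t i - t j \<notin> H"
  shows "measure \<mu> (\<Union>j\<in>J. (+) (t j) ` H) = real (card J) * measure \<mu> H"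
proof -
  have "disjoint_family_on (\<lambda>j. (+) (t j) ` H) J"
    unfolding disjoint_family_on_def
  proof (intro ballI impI equals0I)
    fix i j y assume ij: "i \<in> J" "j \<in> J" "i \<noteq> j" and "y \<in> (+) (t i) ` H \<inter> (+) (t j) ` H"
    then obtain h h' where h: "h \<in> H" "h' \<in> H" "t i + h = t j + h'" by auto
    then have "t i - t j = h' - h" by (simp add: algebra_simps)
    then show False using t[OF ij] h add_subgroup_diff[OF H(1)] by simp
  qed
  moreover have "(+) (t j) ` H \<in> fmeasurable \<mu>" for j
    using haar_measure_fmeasurable[OF \<mu>] compact_translation_group[OF H(2)] by blast
  ultimately have "measure \<mu> (\<Union>j\<in>J. (+) (t j) ` H) = (\<Sum>j\<in>J. measure \<mu> ((+) (t j) ` H))"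
    using J by (intro measure_finite_Union) (auto simp: fmeasurable_def less_top)
  then show ?thesis using haar_measure_translate[OF \<mu> borel_compact[OF H(2)]] by simp
qed

section \<open>Index of a subgroup and index of its annihilator\<close>

lemma char_of_int_mult: "char_of \<xi> (int_mult i x) = char_of \<xi> x powi i"
proof (induction i rule: int_induct[where k = 0])
  case (step1 i)
  then show ?case by (simp add: int_mult_succ char_of_add power_int_add)
next
  case (step2 i)
  then show ?case by (simp add: int_mult_pred char_of_diff power_int_diff)
qed simp

lemma power_int_unity:
  assumes "z ^ k = (1 :: complex)" "int k dvd i"
  shows "z powi i = 1"
proof -
  obtain q where "i = int k * q" using assms(2) by blast
  then show ?thesis using assms(1) by (simp add: power_int_mult)
qed

text \<open>The index of \<open>C\<close> in the subgroup generated by \<open>C\<close> and \<open>x\<close> is the order \<open>k\<close> of \<open>x\<close> modulo \<open>C\<close>; the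
  index of the annihilators is also \<open>k\<close>, since evaluation at \<open>x\<close> maps the annihilator of \<open>C\<close> onto the
  \<open>k\<close>-th roots of unity.\<close>

lemma measure_annihilator_step:
  fixes \<mu> :: "'a::{topological_ab_group_add, t2_space} measure" and \<nu> :: "'a dual measure"
  assumes \<mu>: "haar_measure \<mu>" and \<nu>: "haar_measure \<nu>"
    and C: "compact_open_subgroup C" and U: "compact_open_subgroup U"
    and CU: "C \<subseteq> U" and x: "x \<in> U" "x \<notin> C"
  obtains C' where "compact_open_subgroup C'" "C' \<subseteq> U" "2 * measure \<mu> C \<le> measure \<mu> C'"
    "measure \<mu> C * measure \<nu> (annihilator C) = measure \<mu> C' * measure \<nu> (annihilator C')"
proof -
  have Cs: "add_subgroup C" "open C" "compact C" and Us: "add_subgroup U" "compact U"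
    using C U by (auto simp: compact_open_subgroup_def)
  \<comment> \<open>Stated for a general bound \<open>m\<close> because it serves twice: for every
    \<open>m\<close> in showing that \<open>x\<close> has finite order modulo \<open>C\<close>, and
    for \<open>m = k\<close> in counting the cosets.\<close>
  have apart: "int_mult (int i) x - int_mult (int j) x \<notin> C"
    if none: "\<And>l. l > 0 \<Longrightarrow> l < m \<Longrightarrow> int_mult (int l) x \<notin> C" and ij: "i < m" "j < m" "i \<noteq> j" for i j m
  proof
    assume *: "int_mult (int i) x - int_mult (int j) x \<in> C"
    then have **: "int_mult (int j) x - int_mult (int i) x \<in> C"
      using add_subgroup_uminus[OF Cs(1) *] by simp
    show False
    proof (cases "i < j")
      case True
      then have "int_mult (int (j - i)) x \<in> C" using ** by (simp add: of_nat_diff int_mult_diff)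
      then show False using none[of "j - i"] ij True by (metis zero_less_diff less_imp_diff_less)
    next
      case False
      then have "int_mult (int (i - j)) x \<in> C" using * by (simp add: of_nat_diff int_mult_diff)
      then show False using none[of "i - j"] ij False
        by (metis zero_less_diff less_imp_diff_less linorder_neqE_nat)
    qed
  qed
  \<comment> \<open>Infinite order would place arbitrarily many disjoint translates of
    \<open>C\<close>, all of the same positive measure, inside \<open>U\<close>.\<close>
  have "\<exists>k>0. int_mult (int k) x \<in> C"
  proof (rule ccontr)
    assume none: "\<not> ?thesis"
    have "real n * measure \<mu> C \<le> measure \<mu> U" for n
    proof -
      have "measure \<mu> (\<Union>j\<in>{..<n}. (+) (int_mult (int j) x) ` C) = real (card {..<n}) * measure \<mu> C"
      proof (rule haar_measure_cosets[OF \<mu> Cs(1,3)])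
        fix i j assume "i \<in> {..<n}" "j \<in> {..<n}" "i \<noteq> j"
        then show "int_mult (int i) x - int_mult (int j) x \<notin> C"
          using none by (intro apart[of n]) blast+
      qed simp
      moreover have "(\<Union>j\<in>{..<n}. (+) (int_mult (int j) x) ` C) \<subseteq> U"
        using CU by (auto intro!: add_subgroup_add[OF Us(1)] add_subgroup_int_mult[OF Us(1) x(1)])
      then have "measure \<mu> (\<Union>j\<in>{..<n}. (+) (int_mult (int j) x) ` C) \<le> measure \<mu> U"
        by (intro haar_measure_mono[OF \<mu> _ Us(2)] compact_UN compact_translation_group[OF Cs(3)]) auto
      ultimately show ?thesis by simp
    qed
    then show False
      using reals_Archimedean3[OF compact_open_subgroup_measure_pos[OF \<mu> C], rule_format, of "measure \<mu> U"]
      by (auto simp: not_less[symmetric])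
  qed
  define k where "k = (LEAST k::nat. k > 0 \<and> int_mult (int k) x \<in> C)"
  have "k > 0 \<and> int_mult (int k) x \<in> C"
    unfolding k_def by (rule LeastI_ex) fact
  then have k: "k > 0" "int_mult (int k) x \<in> C" by auto
  have least: "int_mult (int l) x \<notin> C" if "l > 0" "l < k" for l
    using not_less_Least[of l "\<lambda>k. k > 0 \<and> int_mult (int k) x \<in> C"] that unfolding k_def by blast
  \<comment> \<open>This is the origin of the factor 2: \<open>x\<close> lies outside
    \<open>C\<close>, so its order modulo \<open>C\<close> is at least 2.\<close>
  have "k \<noteq> 1" using x(2) k(2) by auto
  then have "k \<ge> 2" using k(1) by linarith
  have reduce: "\<exists>c\<in>C. int_mult i x = int_mult (int (nat (i mod int k))) x + c" for i
  proof
    show "int_mult (i div int k) (int_mult (int k) x) \<in> C"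
      by (rule add_subgroup_int_mult[OF Cs(1) k(2)])
    have "i = int (nat (i mod int k)) + i div int k * int k" using k(1) by simp
    then show "int_mult i x = int_mult (int (nat (i mod int k))) x + int_mult (i div int k) (int_mult (int k) x)"
      by (metis int_mult_add int_mult_mult)
  qed
  have mod_less: "nat (i mod int k) < k" for i using k(1) by (simp add: nat_less_iff)
  have dvd: "int k dvd i" if i: "int_mult i x \<in> C" for i
  proof -
    obtain c where c: "c \<in> C" "int_mult i x = int_mult (int (nat (i mod int k))) x + c"
      using reduce by blast
    then have "int_mult (int (nat (i mod int k))) x \<in> C"
      using add_subgroup_diff[OF Cs(1) i c(1)] by simp
    then have "nat (i mod int k) = 0" using least mod_less by blast
    moreover have "i mod int k \<ge> 0" using k(1) by simp
    ultimately show ?thesis unfolding dvd_eq_mod_eq_0 by linarith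
  qed

  define C' where "C' = {int_mult i x + c | i c. c \<in> C}"
  have C'I: "int_mult i x + c \<in> C'" if "c \<in> C" for i c using that by (auto simp: C'_def)
  have "C \<subseteq> C'"
  proof
    fix c assume "c \<in> C"
    then show "c \<in> C'" using C'I[of c 0] by simp
  qed
  have "C' \<subseteq> U"
    using CU by (auto simp: C'_def intro!: add_subgroup_add[OF Us(1)] add_subgroup_int_mult[OF Us(1) x(1)])
  have xC': "x \<in> C'" using C'I[of 0 1] add_subgroup_0[OF Cs(1)] by simp
  have C's: "add_subgroup C'"
    unfolding add_subgroup_def
  proof (intro conjI ballI)
    show "0 \<in> C'" using \<open>C \<subseteq> C'\<close> add_subgroup_0[OF Cs(1)] by blast
    fix y z assume "y \<in> C'" "z \<in> C'"
    then obtain i c j d where "y = int_mult i x + c" "z = int_mult j x + d" "c \<in> C" "d \<in> C"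
      by (auto simp: C'_def)
    then have "y - z = int_mult (i - j) x + (c - d)" "c - d \<in> C"
      using add_subgroup_diff[OF Cs(1)] by (auto simp: int_mult_diff)
    then show "y - z \<in> C'" using C'I by metis
  qed
  have "open C'"
    using add_subgroup_open[OF C's add_subgroup_0[OF Cs(1)] Cs(2) \<open>C \<subseteq> C'\<close>] .
  then have C': "compact_open_subgroup C'"
    by (rule compact_open_subgroup_subset[OF U C's _ \<open>C' \<subseteq> U\<close>])

  have "C' = (\<Union>j\<in>{..<k}. (+) (int_mult (int j) x) ` C)"
  proof (intro equalityI subsetI)
    fix y assume "y \<in> C'"
    then obtain i c where y: "y = int_mult i x + c" "c \<in> C" by (auto simp: C'_def)
    obtain d where d: "d \<in> C" "int_mult i x = int_mult (int (nat (i mod int k))) x + d"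
      using reduce by blast
    then have "y = int_mult (int (nat (i mod int k))) x + (d + c)" "d + c \<in> C"
      using y add_subgroup_add[OF Cs(1)] by (auto simp: add.assoc)
    then show "y \<in> (\<Union>j\<in>{..<k}. (+) (int_mult (int j) x) ` C)" using mod_less[of i] by blast
  qed (auto intro: C'I)
  then have \<mu>C': "measure \<mu> C' = real k * measure \<mu> C"
    using haar_measure_cosets[OF \<mu> Cs(1,3), of "{..<k}" "\<lambda>j. int_mult (int j) x"] apart[of k] least
    by simp

  define R where "R = {z :: complex. z ^ k = 1}"
  have R: "finite R" "card R = k"
    using finite_roots_unity[of k] card_roots_unity_eq[of k] k(1) by (simp_all add: R_def)
  \<comment> \<open>Sending \<open>x\<close> to \<open>z\<close> and \<open>C\<close> to 1 is well
    defined on \<open>C'\<close>, because \<open>int_mult i x \<in> C\<close> forces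
    \<open>k\<close> to divide \<open>i\<close>, whence \<open>z powi i = 1\<close>.\<close>
  have "\<exists>\<xi>. \<xi> \<in> annihilator C \<and> char_of \<xi> x = z" if "z \<in> R" for z
  proof -
    have zk: "z ^ k = 1" using that by (simp add: R_def)
    have "norm z ^ k = 1" using zk by (metis norm_one norm_power)
    then have norm_z: "norm z = 1" using k(1) power_eq_iff_eq_base[of k "norm z" 1] by simp
    then have "z \<noteq> 0" by auto
    define P where "P = {(int_mult i x + c, z powi i) | i c. c \<in> C}"
    have PI: "(int_mult i x + c, z powi i) \<in> P" if "c \<in> C" for i c using that by (auto simp: P_def)
    have "circle_hom_graph P"
      unfolding circle_hom_graph_def
    proof (intro conjI allI impI)
      show "(0, 1) \<in> P" using PI[of 0 0] add_subgroup_0[OF Cs(1)] by simp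
    next
      fix y w assume "(y, w) \<in> P"
      then show "norm w = 1" using norm_z by (auto simp: P_def norm_power_int)
    next
      fix y w y' w' assume "(y, w) \<in> P" "(y', w') \<in> P"
      then obtain i c j d where *: "y = int_mult i x + c" "y' = int_mult j x + d" "c \<in> C" "d \<in> C"
        "w = z powi i" "w' = z powi j"
        by (auto simp: P_def)
      then have "y - y' = int_mult (i - j) x + (c - d)" "w / w' = z powi (i - j)"
        using \<open>z \<noteq> 0\<close> by (auto simp: int_mult_diff power_int_diff)
      then show "(y - y', w / w') \<in> P" using PI add_subgroup_diff[OF Cs(1) *(3,4)] by metis
    next
      fix w assume "(0, w) \<in> P"
      then obtain i c where *: "0 = int_mult i x + c" "c \<in> C" "w = z powi i" by (auto simp: P_def)
      then have "int_mult i x = - c" by (simp add: eq_neg_iff_add_eq_0)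
      then have "int k dvd i" using dvd add_subgroup_uminus[OF Cs(1) *(2)] by simp
      then show "w = 1" using *(3) power_int_unity[OF zk] by simp
    qed
    then obtain F where F: "\<And>x. norm (F x) = 1" "\<And>x y. F (x + y) = F x * F y"
      "\<And>x z. (x, z) \<in> P \<Longrightarrow> F x = z"
      using circle_hom_extension by metis
    have FC: "F c = 1" if "c \<in> C" for c using F(3) PI[OF that, of 0] by simp
    have "F x = z" using F(3) PI[of 0 1] add_subgroup_0[OF Cs(1)] by simp
    have "is_character F"
      using F FC add_subgroup_0[OF Cs(1)] by (intro circle_hom_is_character[OF Cs(2)]) auto
    then have "char_of (Abs_dual F) = F" by (simp add: Abs_dual_inverse)
    then show ?thesis using FC \<open>F x = z\<close> by (intro exI[of _ "Abs_dual F"]) (auto simp: annihilator_def)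
  qed
  then obtain \<xi> where \<xi>: "\<And>z. z \<in> R \<Longrightarrow> \<xi> z \<in> annihilator C \<and> char_of (\<xi> z) x = z" by metis
  \<comment> \<open>Two characters trivial on \<open>C\<close> differ by one trivial on
    \<open>C'\<close> exactly when they agree at \<open>x\<close>, so the value at \<open>x\<close>
    labels the coset.\<close>
  have "annihilator C = (\<Union>z\<in>R. (+) (\<xi> z) ` annihilator C')"
  proof (intro equalityI subsetI)
    fix \<eta> assume \<eta>: "\<eta> \<in> annihilator C"
    define z where "z = char_of \<eta> x"
    have "z ^ k = char_of \<eta> (int_mult (int k) x)" by (simp add: z_def char_of_int_mult)
    then have z: "z \<in> R" using \<eta> k(2) by (simp add: R_def annihilator_def)
    have "\<eta> - \<xi> z \<in> annihilator C'"
      using \<eta> \<xi>[OF z] 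
      by (auto simp: annihilator_def C'_def char_of_minus_dual char_of_add char_of_int_mult z_def)
    then show "\<eta> \<in> (\<Union>z\<in>R. (+) (\<xi> z) ` annihilator C')"
      using z by (intro UN_I[of z] image_eqI[of _ _ "\<eta> - \<xi> z"]) auto
  next
    fix \<eta> assume "\<eta> \<in> (\<Union>z\<in>R. (+) (\<xi> z) ` annihilator C')"
    then obtain z \<zeta> where *: "z \<in> R" "\<zeta> \<in> annihilator C'" "\<eta> = \<xi> z + \<zeta>" by blast
    then have "\<zeta> \<in> annihilator C" using annihilator_antimono[OF \<open>C \<subseteq> C'\<close>] by blast
    then show "\<eta> \<in> annihilator C"
      using * \<xi> by (simp add: add_subgroup_add[OF add_subgroup_annihilator])
  qed
  moreover have "\<xi> z - \<xi> w \<notin> annihilator C'" if "z \<in> R" "w \<in> R" "z \<noteq> w" for z w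
  proof
    assume "\<xi> z - \<xi> w \<in> annihilator C'"
    then have "char_of (\<xi> z - \<xi> w) x = 1" using xC' by (simp add: annihilator_def)
    then have "char_of (\<xi> z) x = char_of (\<xi> w) x" by (simp add: char_of_minus_dual)
    then show False using \<xi> that by simp
  qed
  moreover have "compact (annihilator C')"
    using compact_open_subgroup_annihilator[OF C'] by (simp add: compact_open_subgroup_def)
  ultimately have "measure \<nu> (annihilator C) = real k * measure \<nu> (annihilator C')"
    using haar_measure_cosets[OF \<nu> add_subgroup_annihilator _ R(1), of C' \<xi>] R(2) by simp
  with \<mu>C' have "measure \<mu> C * measure \<nu> (annihilator C) = measure \<mu> C' * measure \<nu> (annihilator C')"
    by simp
  moreover have "2 * measure \<mu> C \<le> measure \<mu> C'"
    unfolding \<mu>C' using \<open>k \<ge> 2\<close> by (intro mult_right_mono) auto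
  ultimately show thesis using that C' \<open>C' \<subseteq> U\<close> by blast
qed

text \<open>Each enlargement of \<open>C\<close> preserves the product and at least doubles
  \<open>measure \<mu> C\<close>, which is bounded by \<open>measure \<mu> U\<close>. The induction
  is on the number \<open>n\<close> of doublings that suffice to exceed
  \<open>measure \<mu> U\<close>.\<close>

lemma measure_annihilator:
  fixes \<mu> :: "'a::{topological_ab_group_add, t2_space} measure" and \<nu> :: "'a dual measure"
  assumes \<mu>: "haar_measure \<mu>" and \<nu>: "haar_measure \<nu>"
    and C: "compact_open_subgroup C" and U: "compact_open_subgroup U" and CU: "C \<subseteq> U"
  shows "measure \<mu> C * measure \<nu> (annihilator C) = measure \<mu> U * measure \<nu> (annihilator U)"
proof -
  obtain n where "measure \<mu> U / measure \<mu> C < 2 ^ n"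
    using real_arch_pow[of 2 "measure \<mu> U / measure \<mu> C"] by auto
  then have "measure \<mu> U < 2 ^ n * measure \<mu> C"
    using compact_open_subgroup_measure_pos[OF \<mu> C] by (simp add: field_simps)
  then show ?thesis using C CU
  proof (induction n arbitrary: C)
    case 0
    \<comment> \<open>For \<open>n = 0\<close> the hypothesis reads
      \<open>measure \<mu> U < measure \<mu> C\<close>, which contradicts
      \<open>C \<subseteq> U\<close>.\<close>
    then have "measure \<mu> C \<le> measure \<mu> U"
      using U by (intro haar_measure_mono[OF \<mu>]) (auto simp: compact_open_subgroup_def)
    with 0 show ?case by simp
  next
    case (Suc n)
    show ?case
    proof (cases "C = U")
      case False
      then obtain x where "x \<in> U" "x \<notin> C" using Suc.prems by blast
      then obtain C' where C': "compact_open_subgroup C'" "C' \<subseteq> U" "2 * measure \<mu> C \<le> measure \<mu> C'"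
        "measure \<mu> C * measure \<nu> (annihilator C) = measure \<mu> C' * measure \<nu> (annihilator C')"
        using measure_annihilator_step[OF \<mu> \<nu> Suc.prems(2) U Suc.prems(3)] by metis
      have "measure \<mu> U < 2 ^ n * (2 * measure \<mu> C)" using Suc.prems(1) by (simp add: mult_ac)
      also have "\<dots> \<le> 2 ^ n * measure \<mu> C'" using C'(3) by (intro mult_left_mono) auto
      finally have "measure \<mu> U < 2 ^ n * measure \<mu> C'" .
      then show ?thesis using Suc.IH[OF _ C'(1,2)] C'(4) by simp
    qed simp
  qed
qed

section \<open>Entropy\<close>

lemma cotrajectory_antimono: "U \<subseteq> V \<Longrightarrow> cotrajectory \<phi> U n \<subseteq> cotrajectory \<phi> V n"
  by (auto simp: cotrajectory_def)

lemma cotrajectory_subset: "n > 0 \<Longrightarrow> cotrajectory \<phi> U n \<subseteq> U"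
  by (auto simp: cotrajectory_def dest!: INT_D[of _ _ _ 0])

text \<open>A closed subset of the compact \<open>U\<close>, containing the open cotrajectory of the
  interior of \<open>U\<close>. For \<open>n = 0\<close> it would be \<open>UNIV\<close>, which may
  fail to be compact.\<close>

lemma cotrajectory_compact_nhds0:
  fixes U :: "'a::{topological_ab_group_add, t2_space} set"
  assumes \<phi>: "continuous_endo \<phi>" and U: "U \<in> compact_nhds0" and n: "n > 0"
  shows "cotrajectory \<phi> U n \<in> compact_nhds0"
proof -
  have "closed U" using U by (simp add: compact_nhds0_def compact_imp_closed)
  then have "closed (cotrajectory \<phi> U n)"
    unfolding cotrajectory_def using continuous_endo_funpow[OF \<phi>]
    by (intro closed_INT ballI closed_vimage) (auto simp: continuous_endo_def)
  moreover have "compact U" using U by (simp add: compact_nhds0_def)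
  ultimately have "compact (U \<inter> cotrajectory \<phi> U n)" by (intro compact_Int_closed)
  then have "compact (cotrajectory \<phi> U n)"
    using cotrajectory_subset[OF n] by (metis Int_absorb1)
  moreover have "open (cotrajectory \<phi> (interior U) n)"
    by (rule open_cotrajectory[OF \<phi> open_interior])
  then have "cotrajectory \<phi> (interior U) n \<subseteq> interior (cotrajectory \<phi> U n)"
    by (intro interior_maximal cotrajectory_antimono interior_subset)
  moreover have "0 \<in> cotrajectory \<phi> (interior U) n"
    using U continuous_endo_0[OF continuous_endo_funpow[OF \<phi>]]
    by (simp add: cotrajectory_def compact_nhds0_def)
  ultimately show ?thesis by (auto simp: compact_nhds0_def)
qed

lemma trajectory_mono: "U \<subseteq> V \<Longrightarrow> trajectory \<phi> U n \<subseteq> trajectory \<phi> V n"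
  by (induction n) (simp_all add: trajectory_0 trajectory_Suc set_plus_mono2 image_mono)

lemma compact_set_plus:
  fixes A B :: "'a::topological_ab_group_add set"
  assumes "compact A" "compact B"
  shows "compact (A + B)"
  unfolding set_plus_image case_prod_beta
  using assms by (intro compact_continuous_image compact_Times continuous_intros)

text \<open>Every summand contains 0, so a nonempty sum contains \<open>U\<close>. The empty sum
  \<open>{0}\<close> may fail to be a neighbourhood.\<close>

lemma trajectory_compact_nhds0:
  fixes U :: "'a::{topological_ab_group_add, t2_space} set"
  assumes \<phi>: "continuous_endo \<phi>" and U: "U \<in> compact_nhds0" and n: "n > 0"
  shows "trajectory \<phi> U n \<in> compact_nhds0"
proof -
  have "compact U" using U by (simp add: compact_nhds0_def)
  then have image: "compact ((\<phi> ^^ k) ` U)" for k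
    using continuous_endo_funpow[OF \<phi>, of k]
    by (intro compact_continuous_image) (auto simp: continuous_endo_def intro: continuous_on_subset)
  have "compact (trajectory \<phi> U n)"
    by (induction n) (simp_all add: trajectory_0 trajectory_Suc compact_set_plus image)
  moreover have "U \<subseteq> trajectory \<phi> U n"
    using n
  proof (induction n rule: nat_induct_non_zero)
    case 1
    show ?case using trajectory_Suc[of \<phi> U 0] by (simp add: trajectory_0)
  next
    case (Suc n)
    have "0 \<in> U" using U interior_subset by (auto simp: compact_nhds0_def)
    then have "0 \<in> (\<phi> ^^ n) ` U"
      using continuous_endo_0[OF continuous_endo_funpow[OF \<phi>, of n]] by (metis image_eqI)
    then have "trajectory \<phi> U n \<subseteq> trajectory \<phi> U (Suc n)"
      using set_zero_plus2[of "(\<phi> ^^ n) ` U" "trajectory \<phi> U n"] by (simp add: trajectory_Suc add.commute)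
    with Suc.IH show ?case by blast
  qed
  then have "interior U \<subseteq> interior (trajectory \<phi> U n)" by (rule interior_mono)
  ultimately show ?thesis using U by (auto simp: compact_nhds0_def)
qed

lemma continuous_endo_dual_endo:
  fixes \<phi> :: "'a::topological_ab_group_add \<Rightarrow> 'a"
  assumes \<phi>: "continuous_endo \<phi>"
  shows "continuous_endo (dual_endo \<phi>)"
proof -
  have "char_of (dual_endo \<phi> (\<xi> + \<zeta>)) = char_of (dual_endo \<phi> \<xi> + dual_endo \<phi> \<zeta>)" for \<xi> \<zeta>
    by (simp add: char_of_dual_endo[OF \<phi>] plus_dual.rep_eq fun_eq_iff)
  then have "Modules.additive (dual_endo \<phi>)" by (simp add: Modules.additive_def char_of_inject)
  moreover have "continuous_on UNIV (dual_endo \<phi>)"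
    unfolding continuous_on_def tendsto_dual_iff
  proof (intro ballI allI impI uniform_limitI)
    fix \<xi> :: "'a dual" and K :: "'a set" and e :: real
    assume K: "compact K" and e: "e > 0"
    have "compact (\<phi> ` K)"
      using \<phi> K by (intro compact_continuous_image) (auto simp: continuous_endo_def intro: continuous_on_subset)
    moreover have "((\<lambda>\<zeta>. \<zeta>) \<longlongrightarrow> \<xi>) (at \<xi>)" by (rule tendsto_ident_at)
    ultimately have "uniform_limit (\<phi> ` K) char_of (char_of \<xi>) (at \<xi>)"
      unfolding tendsto_dual_iff by blast
    from uniform_limitD[OF this e]
    show "\<forall>\<^sub>F \<zeta> in at \<xi>. \<forall>x\<in>K. dist (char_of (dual_endo \<phi> \<zeta>) x) (char_of (dual_endo \<phi> \<xi>) x) < e"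
      by (simp add: char_of_dual_endo[OF \<phi>])
  qed
  ultimately show ?thesis by (simp add: continuous_endo_def)
qed

lemma H_top_antimono:
  fixes \<mu> :: "'a::{topological_ab_group_add, t2_space} measure"
  assumes \<phi>: "continuous_endo \<phi>" and \<mu>: "haar_measure \<mu>"
    and U: "U \<in> compact_nhds0" and V: "V \<in> compact_nhds0" and UV: "U \<subseteq> V"
  shows "H_top \<mu> \<phi> V \<le> H_top \<mu> \<phi> U"
  unfolding H_top_def
proof (intro Limsup_mono eventually_sequentiallyI[of 1])
  fix n :: nat assume "1 \<le> n"
  then have *: "cotrajectory \<phi> U n \<in> compact_nhds0" "cotrajectory \<phi> V n \<in> compact_nhds0"
    using U V by (auto intro: cotrajectory_compact_nhds0[OF \<phi>])
  then have "measure \<mu> (cotrajectory \<phi> U n) \<le> measure \<mu> (cotrajectory \<phi> V n)"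
    by (intro haar_measure_mono[OF \<mu>] cotrajectory_antimono[OF UV]) (simp_all add: compact_nhds0_def)
  then have "ln (measure \<mu> (cotrajectory \<phi> U n)) \<le> ln (measure \<mu> (cotrajectory \<phi> V n))"
    using haar_measure_pos[OF \<mu> *(1)] by simp
  then show "ereal (- ln (measure \<mu> (cotrajectory \<phi> V n)) / real n)
      \<le> ereal (- ln (measure \<mu> (cotrajectory \<phi> U n)) / real n)"
    by (simp add: divide_right_mono)
qed

lemma H_alg_mono:
  fixes \<mu> :: "'a::{topological_ab_group_add, t2_space} measure"
  assumes \<phi>: "continuous_endo \<phi>" and \<mu>: "haar_measure \<mu>"
    and U: "U \<in> compact_nhds0" and V: "V \<in> compact_nhds0" and UV: "U \<subseteq> V"
  shows "H_alg \<mu> \<phi> U \<le> H_alg \<mu> \<phi> V"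
  unfolding H_alg_def
proof (intro Limsup_mono eventually_sequentiallyI[of 1])
  fix n :: nat assume "1 \<le> n"
  then have *: "trajectory \<phi> U n \<in> compact_nhds0" "trajectory \<phi> V n \<in> compact_nhds0"
    using U V by (auto intro: trajectory_compact_nhds0[OF \<phi>])
  then have "measure \<mu> (trajectory \<phi> U n) \<le> measure \<mu> (trajectory \<phi> V n)"
    by (intro haar_measure_mono[OF \<mu>] trajectory_mono[OF UV]) (simp_all add: compact_nhds0_def)
  then have "ln (measure \<mu> (trajectory \<phi> U n)) \<le> ln (measure \<mu> (trajectory \<phi> V n))"
    using haar_measure_pos[OF \<mu> *(1)] by simp
  then show "ereal (ln (measure \<mu> (trajectory \<phi> U n)) / real n)
      \<le> ereal (ln (measure \<mu> (trajectory \<phi> V n)) / real n)"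
    by (simp add: divide_right_mono)
qed

lemma H_top_eq_H_alg_annihilator:
  fixes \<phi> :: "'a::{topological_ab_group_add, t2_space} \<Rightarrow> 'a"
  assumes \<phi>: "continuous_endo \<phi>" and \<mu>: "haar_measure \<mu>" and \<nu>: "haar_measure \<nu>"
    and U: "compact_open_subgroup U"
  shows "H_top \<mu> \<phi> U = H_alg \<nu> (dual_endo \<phi>) (annihilator U)"
proof -
  define c where "c = measure \<mu> U * measure \<nu> (annihilator U)"
  have Us: "add_subgroup U" "open U" using U by (auto simp: compact_open_subgroup_def)
  \<comment> \<open>\<open>c\<close> does not depend on \<open>n\<close>: for
    \<open>n \<ge> 1\<close> the cotrajectory is a compact open subgroup of \<open>U\<close>, so
    \<open>measure_annihilator\<close> gives the same product for all of them.\<close>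
  have eq: "ereal (- ln (measure \<mu> (cotrajectory \<phi> U n)) / real n) =
      ereal (- ln c / real n) + ereal (ln (measure \<nu> (trajectory (dual_endo \<phi>) (annihilator U) n)) / real n)"
    if n: "n \<ge> 1" for n
  proof -
    have sub: "cotrajectory \<phi> U n \<subseteq> U" using n by (intro cotrajectory_subset) simp
    have C: "compact_open_subgroup (cotrajectory \<phi> U n)"
      using compact_open_subgroup_subset[OF U add_subgroup_cotrajectory[OF \<phi> Us(1)]
          open_cotrajectory[OF \<phi> Us(2)] sub] .
    have "measure \<mu> (cotrajectory \<phi> U n) > 0" "measure \<nu> (annihilator (cotrajectory \<phi> U n)) > 0"
      using compact_open_subgroup_measure_pos[OF \<mu> C]
        compact_open_subgroup_measure_pos[OF \<nu> compact_open_subgroup_annihilator[OF C]] by auto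
    then have "ln c = ln (measure \<mu> (cotrajectory \<phi> U n)) + ln (measure \<nu> (annihilator (cotrajectory \<phi> U n)))"
      unfolding c_def measure_annihilator[OF \<mu> \<nu> C U sub, symmetric] by (simp add: ln_mult)
    then show ?thesis
      using annihilator_cotrajectory[OF \<phi> Us, of n] by (simp add: diff_divide_distrib add_divide_distrib)
  qed
  have "H_top \<mu> \<phi> U = limsup (\<lambda>n. ereal (- ln c / real n) +
      ereal (ln (measure \<nu> (trajectory (dual_endo \<phi>) (annihilator U) n)) / real n))"
    unfolding H_top_def by (intro Limsup_eq eventually_sequentiallyI[of 1] eq)
  \<comment> \<open>The correction has the finite limit 0, so it can be split off the limit superior
    even where the latter is infinite.\<close>
  also have "(\<lambda>n. ereal (- ln c / real n)) \<longlonglongrightarrow> ereal 0"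
    by (intro tendsto_ereal lim_const_over_n)
  then have "limsup (\<lambda>n. ereal (- ln c / real n) +
      ereal (ln (measure \<nu> (trajectory (dual_endo \<phi>) (annihilator U) n)) / real n))
      = ereal 0 + H_alg \<nu> (dual_endo \<phi>) (annihilator U)"
    unfolding H_alg_def by (rule ereal_limsup_lim_add) simp
  finally show ?thesis by simp
qed

theorem theorem1p4:
  fixes \<phi> :: "'a::{topological_ab_group_add, t2_space} \<Rightarrow> 'a"
    and \<mu> :: "'a measure"
    and \<nu> :: "'a dual measure"
  assumes "locally_compact_space (euclidean :: 'a topology)"
    and "totally_disconnected (UNIV :: 'a set)"
    and "continuous_endo \<phi>"
    and "haar_measure \<mu>"
    and "haar_measure \<nu>"
  shows "h_top \<mu> \<phi> = h_alg \<nu> (dual_endo \<phi>)"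
proof (rule antisym)
  show "h_top \<mu> \<phi> \<le> h_alg \<nu> (dual_endo \<phi>)"
    unfolding h_top_def
  proof (rule SUP_least)
    fix U :: "'a set" assume U: "U \<in> compact_nhds0"
    then have "0 \<in> interior U" by (simp add: compact_nhds0_def)
    then obtain H where H: "compact_open_subgroup H" "H \<subseteq> interior U"
      by (rule van_Dantzig[OF assms(1,2) open_interior])
    then have "H_top \<mu> \<phi> U \<le> H_top \<mu> \<phi> H"
      using interior_subset[of U]
      by (intro H_top_antimono[OF assms(3,4) compact_open_subgroup_nhds U]) auto
    also have "\<dots> = H_alg \<nu> (dual_endo \<phi>) (annihilator H)"
      by (rule H_top_eq_H_alg_annihilator[OF assms(3-5) H(1)])
    also have "\<dots> \<le> h_alg \<nu> (dual_endo \<phi>)"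
      unfolding h_alg_def
      by (intro SUP_upper compact_open_subgroup_nhds compact_open_subgroup_annihilator H(1))
    finally show "H_top \<mu> \<phi> U \<le> h_alg \<nu> (dual_endo \<phi>)" .
  qed
  show "h_alg \<nu> (dual_endo \<phi>) \<le> h_top \<mu> \<phi>"
    unfolding h_alg_def
  proof (rule SUP_least)
    fix K :: "'a dual set" assume K: "K \<in> compact_nhds0"
    then have "compact K" by (simp add: compact_nhds0_def)
    \<comment> \<open>Annihilation reverses inclusion: small neighbourhoods matter for
      \<open>h_top\<close>, large ones for \<open>h_alg\<close>, and \<open>annihilator H\<close>
      grows as \<open>H\<close> shrinks.\<close>
    then obtain H where H: "compact_open_subgroup H" "K \<subseteq> annihilator H"
      by (rule compact_subset_annihilator[OF assms(1,2)])
    then have "H_alg \<nu> (dual_endo \<phi>) K \<le> H_alg \<nu> (dual_endo \<phi>) (annihilator H)"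
      by (intro H_alg_mono[OF continuous_endo_dual_endo[OF assms(3)] assms(5) K]
          compact_open_subgroup_nhds compact_open_subgroup_annihilator)
    also have "\<dots> = H_top \<mu> \<phi> H"
      by (rule H_top_eq_H_alg_annihilator[OF assms(3-5) H(1), symmetric])
    also have "\<dots> \<le> h_top \<mu> \<phi>"
      unfolding h_top_def by (intro SUP_upper compact_open_subgroup_nhds H(1))
    finally show "H_alg \<nu> (dual_endo \<phi>) K \<le> h_top \<mu> \<phi>" .
  qed
qed

end
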